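(* For a group $\Gamma\subset PGL_{2n+2}(\mathbb{C})$ of type $\mathcal{L}$, the limit set $\Lambda(\Gamma)$ is a closed, nowhere dense, $\Gamma$-invariant subset of $\mathbb{P}^{2n+1}$.
   Context: Fix $n\geq1$. An $n$-plane is an $n$-dimensional projective linear subspace of $\mathbb{P}^{2n+1}$; $|\ell|$ denotes its point set. Let $N=\binom{2n+2}{n+1}-1$, $\mathbb{P}^N=\mathbb{P}(\Lambda^{n+1}\mathbb{C}^{2n+2})$, and $\mathcal{G}\subset\mathbb{P}^N$ the Grassmannian $Gr(n+1,2n+2)$ embedded by Plücker coordinates; $\hat\ell\in\mathcal{G}$ is the point of an $n$-plane $\ell$. Each $\sigma\in PGL_{2n+2}(\mathbb{C})$ induces $\hat\sigma\in PGL_{N+1}(\mathbb{C})$ via $\Lambda^{n+1}$ of a representative. For a sequence $(\tau_\nu)$ of pairwise distinct elements of $PGL_{m+1}(\mathbb{C})$, pick representatives in $GL_{m+1}(\mathbb{C})$ whose largest entry in absolute value is $1$; if they can be chosen to converge to $T\in M_{m+1}(\mathbb{C})$, the limit image is $\mathbb{P}(\operatorname{Im}T)$. For a discrete $\Gamma\subset PGL_{2n+2}(\mathbb{C})$, a sequence $(\sigma_\nu)\subset\Gamma$ is normal if it consists of distinct elements and both $(\sigma_\nu)$ and $(\hat\sigma_\nu)$ admit such convergent normalized representatives. An $n$-plane $\ell$ is a limit $n$-plane of $\Gamma$ if $\hat\ell\in\mathcal{G}\cap I(\hat\sigma_\nu)$ for some normal sequence, $I(\hat\sigma_\nu)$ being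 the limit image of $(\hat\sigma_\nu)$. The limit set $\Lambda(\Gamma)$ is the union of $|\ell|$ over all limit $n$-planes $\ell$ of $\Gamma$, and $\Omega(\Gamma)=\mathbb{P}^{2n+1}\setminus\Lambda(\Gamma)$. A domain is large if it contains an $n$-plane; a discrete subgroup $\Gamma$ is of type $\mathcal{L}$ if $\Omega(\Gamma)$ contains a large domain. *)

theory Defs
  imports "HOL-Analysis.Analysis"
begin

type_synonym 'k cvec = "(complex, 'k) vec"
type_synonym 'k cmat = "((complex, 'k) vec, 'k) vec"

text \<open>Ambient space C^(2n+2) is 'k cvec with CARD('k) = 2n+2; 'k is linearly ordered
so that Pluecker coordinates (indexed by (n+1)-subsets of 'k) have a fixed sign convention.
A point of projective space is the set of nonzero scalar multiples of a nonzero vector.\<close>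

definition ppt :: "'k::finite cvec \<Rightarrow> ('k cvec) set" where
  "ppt v = {c *s v | c. c \<noteq> 0}"

definition Pspace :: "('k::finite cvec) set set" where
  "Pspace = {ppt v | v. v \<noteq> 0}"

text \<open>Quotient topology: U is open iff its preimage (the union of the lines) is open.\<close>
definition Ptop :: "('k::finite cvec) set topology" where
  "Ptop = topology (\<lambda>U. U \<subseteq> Pspace \<and> open (\<Union>U))"

definition pcls :: "'k::finite cmat \<Rightarrow> ('k cmat) set" where
  "pcls A = {(\<chi> i j. c * A$i$j) | c. c \<noteq> 0}"

definition PGL :: "('k::finite cmat) set set" where
  "PGL = {pcls A | A. invertible A}"

definition PGLtop :: "('k::finite cmat) set topology" where
  "PGLtop = topology (\<lambda>U. U \<subseteq> PGL \<and> open (\<Union>U))"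

definition pmul :: "('k::finite cmat) set \<Rightarrow> ('k cmat) set \<Rightarrow> ('k cmat) set" where
  "pmul g h = {A ** B | A B. A \<in> g \<and> B \<in> h}"

definition pinv :: "('k::finite cmat) set \<Rightarrow> ('k cmat) set" where
  "pinv g = matrix_inv ` g"

definition pact :: "('k::finite cmat) set \<Rightarrow> ('k cvec) set \<Rightarrow> ('k cvec) set" where
  "pact g p = {A *v v | A v. A \<in> g \<and> v \<in> p}"

definition discrete_subgroup :: "('k::finite cmat) set set \<Rightarrow> bool" where
  "discrete_subgroup \<Gamma> \<longleftrightarrow> \<Gamma> \<subseteq> PGL \<and> pcls (mat 1) \<in> \<Gamma>
     \<and> (\<forall>g\<in>\<Gamma>. \<forall>h\<in>\<Gamma>. pmul g h \<in> \<Gamma>) \<and> (\<forall>g\<in>\<Gamma>. pinv g \<in> \<Gamma>)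
     \<and> (\<forall>g\<in>\<Gamma>. \<exists>U. openin PGLtop U \<and> U \<inter> \<Gamma> = {g})"

definition psets :: "nat \<Rightarrow> 'k::{finite,linorder} set set" where
  "psets n = {I. card I = Suc n}"

text \<open>minor m A I J = det of the m x m submatrix of A with rows I and columns J
  (both listed in increasing order).  These are the matrix entries of Lambda^m A.\<close>
definition minor :: "nat \<Rightarrow> 'k::{finite,linorder} cmat \<Rightarrow> 'k set \<Rightarrow> 'k set \<Rightarrow> complex" where
  "minor m A I J = (\<Sum>p | p permutes {..<m}. of_int (sign p) *
      (\<Prod>r<m. A $ (sorted_list_of_set I ! r) $ (sorted_list_of_set J ! p r)))"

definition hatcls :: "nat \<Rightarrow> ('k::{finite,linorder} cmat) set \<Rightarrow> ('k set \<Rightarrow> 'k set \<Rightarrow> complex) set" where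
  "hatcls n g = {(\<lambda>I J. c * minor (Suc n) A I J) | c A. c \<noteq> 0 \<and> A \<in> g}"

definition nplane_basis :: "nat \<Rightarrow> (nat \<Rightarrow> 'k::finite cvec) \<Rightarrow> bool" where
  "nplane_basis n b \<longleftrightarrow> (\<forall>a. (\<Sum>s<Suc n. a s *s b s) = 0 \<longrightarrow> (\<forall>s<Suc n. a s = 0))"

definition plane_pts :: "nat \<Rightarrow> (nat \<Rightarrow> 'k::finite cvec) \<Rightarrow> ('k cvec) set set" where
  "plane_pts n b = {ppt v | v. v \<noteq> 0 \<and> (\<exists>a. v = (\<Sum>s<Suc n. a s *s b s))}"

definition plucker :: "nat \<Rightarrow> (nat \<Rightarrow> 'k::{finite,linorder} cvec) \<Rightarrow> 'k set \<Rightarrow> complex" where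
  "plucker n b I = (\<Sum>p | p permutes {..<Suc n}. of_int (sign p) *
      (\<Prod>r<Suc n. b (p r) $ (sorted_list_of_set I ! r)))"

definition mat_maxabs :: "'k::finite cmat \<Rightarrow> real" where
  "mat_maxabs A = Max {cmod (A$i$j) | i j. True}"

definition normalized_limit :: "(nat \<Rightarrow> ('k::finite cmat) set) \<Rightarrow> 'k cmat \<Rightarrow> bool" where
  "normalized_limit \<sigma> T \<longleftrightarrow> (\<exists>R. (\<forall>\<nu>. R \<nu> \<in> \<sigma> \<nu> \<and> mat_maxabs (R \<nu>) = 1) \<and> R \<longlonglongrightarrow> T)"

definition normalized_hat_limit :: "nat \<Rightarrow> (nat \<Rightarrow> ('k::{finite,linorder} cmat) set)
     \<Rightarrow> ('k set \<Rightarrow> 'k set \<Rightarrow> complex) \<Rightarrow> bool" where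
  "normalized_hat_limit n \<sigma> T' \<longleftrightarrow> (\<exists>R. (\<forall>\<nu>. R \<nu> \<in> hatcls n (\<sigma> \<nu>)
        \<and> Max {cmod (R \<nu> I J) | I J. I \<in> psets n \<and> J \<in> psets n} = 1)
     \<and> (\<forall>I\<in>psets n. \<forall>J\<in>psets n. (\<lambda>\<nu>. R \<nu> I J) \<longlonglongrightarrow> T' I J))"

definition normal_seq :: "nat \<Rightarrow> ('k::{finite,linorder} cmat) set set \<Rightarrow> (nat \<Rightarrow> ('k cmat) set) \<Rightarrow> bool" where
  "normal_seq n \<Gamma> \<sigma> \<longleftrightarrow> (\<forall>\<nu>. \<sigma> \<nu> \<in> \<Gamma>) \<and> inj \<sigma> \<and> (\<exists>T. normalized_limit \<sigma> T)
     \<and> (\<exists>T'. normalized_hat_limit n \<sigma> T')"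

text \<open>b spans a limit n-plane: its Pluecker point lies in the limit image P(Im T') of some
  normal sequence (hat l lies in the Grassmannian automatically).\<close>
definition limit_plane :: "nat \<Rightarrow> ('k::{finite,linorder} cmat) set set \<Rightarrow> (nat \<Rightarrow> 'k cvec) \<Rightarrow> bool" where
  "limit_plane n \<Gamma> b \<longleftrightarrow> nplane_basis n b \<and>
     (\<exists>\<sigma> T'. normal_seq n \<Gamma> \<sigma> \<and> normalized_hat_limit n \<sigma> T' \<and>
        (\<exists>x. \<forall>I\<in>psets n. plucker n b I = (\<Sum>J\<in>psets n. T' I J * x J)))"

definition limset :: "nat \<Rightarrow> ('k::{finite,linorder} cmat) set set \<Rightarrow> ('k cvec) set set" where
  "limset n \<Gamma> = \<Union> {plane_pts n b | b. limit_plane n \<Gamma> b}"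

definition type_L :: "nat \<Rightarrow> ('k::{finite,linorder} cmat) set set \<Rightarrow> bool" where
  "type_L n \<Gamma> \<longleftrightarrow> discrete_subgroup \<Gamma> \<and>
     (\<exists>D b. openin Ptop D \<and> connectedin Ptop D \<and> nplane_basis n b \<and> plane_pts n b \<subseteq> D
        \<and> D \<subseteq> Pspace - limset n \<Gamma>)"

end

(* Let T be a limit of the normalized maps Lambda^(n+1) sigma_nu. If T sent some pencil of n-planes to
   two independent vectors, the sigma_nu would carry the (n+2)-dimensional space swept out by the pencil
   to spaces meeting every n-plane, and a limit of intersection points would be a limit point on the
   n-plane contained in Omega. Hence T has rank one on decomposable vectors and its image is a single
   limit n-plane. Limits of rank one maps have rank one with converging images, and a diagonal argument
   realizes them by one normal sequence: the limit set is closed. An n-plane near the one in Omega that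
   is not annihilated by T is moved by the sigma_nu, inside Omega, onto planes converging to the limit n-plane: the limit set
   has empty interior. *)
theory Submission
  imports Defs
begin

section \<open>Determinants indexed by natural numbers\<close>

text \<open>The obstacle is the kernel of a limit map T: where T kills a decomposable vector,
  nothing is known about the images of that n-plane. Every convergence argument therefore first
  secures a nonzero limit. For a pencil on which T is injective this is automatic: its parameters
  can be normalized to a compact sphere, and every accumulation point still has a nonzero image.
  Since (n+1) + (n+2) > 2n+2, the space swept out by a pencil must meet the n-plane in \<Omega>,
  whereas a single n-plane need not. Decomposable vectors span \<Lambda>^(n+1), so rank one on them
  is rank one of T altogether. For closedness, one fixed tuple \<open>a\<close> that is not killed
  by the limit of the maps probes all of them: each sends it to a multiple of the Pluecker vector of
  its own limit n-plane. The passage from Pluecker vectors to n-planes uses reduced bases, whose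
  entries are ratios of Pluecker coordinates; they converge when the vectors converge projectively,
  which also shows that the limit is decomposable. Subsets of projective space are treated as cones
  in C^(2n+2) that contain 0.\<close>

definition ndet :: "nat \<Rightarrow> (nat \<Rightarrow> nat \<Rightarrow> complex) \<Rightarrow> complex" where
  "ndet N M = (\<Sum>p | p permutes {..<N}. of_int (sign p) * (\<Prod>r<N. M (p r) r))"

lemma ndet_cong:
  assumes "\<And>s r. s < N \<Longrightarrow> r < N \<Longrightarrow> M s r = M' s r"
  shows "ndet N M = ndet N M'"
  unfolding ndet_def
proof (rule sum.cong[OF refl])
  fix p assume "p \<in> {p. p permutes {..<N}}"
  then have "p r < N" if "r < N" for r
    using that permutes_in_image[of p "{..<N}" r] by simp
  then have "(\<Prod>r<N. M (p r) r) = (\<Prod>r<N. M' (p r) r)"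
    by (intro prod.cong) (auto simp: assms)
  then show "of_int (sign p) * (\<Prod>r<N. M (p r) r) = of_int (sign p) * (\<Prod>r<N. M' (p r) r)"
    by simp
qed

lemma ndet_permute_rows:
  assumes q: "q permutes {..<N}"
  shows "ndet N (\<lambda>s r. M (q s) r) = of_int (sign q) * ndet N M"
proof -
  have "ndet N M = (\<Sum>p | p permutes {..<N}. of_int (sign (q \<circ> p)) * (\<Prod>r<N. M ((q \<circ> p) r) r))"
    unfolding ndet_def by (rule setum_permutations_compose_left[OF q])
  also have "\<dots> = (\<Sum>p | p permutes {..<N}. of_int (sign q) * (of_int (sign p) * (\<Prod>r<N. M (q (p r)) r)))"
    using q by (intro sum.cong) (simp_all add: sign_compose permutes_imp_permutation[OF finite_lessThan])
  also have "\<dots> = of_int (sign q) * ndet N (\<lambda>s r. M (q s) r)"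
    by (simp add: ndet_def sum_distrib_left)
  finally have *: "ndet N M = of_int (sign q) * ndet N (\<lambda>s r. M (q s) r)" .
  have "of_int (sign q) * of_int (sign q) = (1::complex)"
    by (metis of_int_mult sign_idempotent of_int_1)
  then show ?thesis by (subst *) (simp flip: mult.assoc)
qed

lemma ndet_permute_cols:
  assumes q: "q permutes {..<N}"
  shows "ndet N (\<lambda>s r. M s (q r)) = of_int (sign q) * ndet N M"
proof -
  have *: "(\<Prod>r<N. M ((p \<circ> q) r) (q r)) = (\<Prod>r<N. M (p r) r)" for p
    using permutes_imp_bij[OF q] prod.reindex_bij_betw[of q "{..<N}" "{..<N}" "\<lambda>r. M (p r) r"]
    by simp
  have "ndet N (\<lambda>s r. M s (q r))
      = (\<Sum>p | p permutes {..<N}. of_int (sign (p \<circ> q)) * (\<Prod>r<N. M ((p \<circ> q) r) (q r)))"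
    unfolding ndet_def by (rule sum_permutations_compose_right[OF q])
  also have "\<dots> = (\<Sum>p | p permutes {..<N}. of_int (sign q) * (of_int (sign p) * (\<Prod>r<N. M (p r) r)))"
    unfolding * using q
    by (intro sum.cong) (simp_all add: sign_compose permutes_imp_permutation[OF finite_lessThan])
  finally show ?thesis by (simp add: ndet_def sum_distrib_left)
qed

lemma ndet_identical_rows:
  assumes "i < N" "j < N" "i \<noteq> j" "\<And>r. r < N \<Longrightarrow> M i r = M j r"
  shows "ndet N M = 0"
proof -
  have "ndet N M = ndet N (\<lambda>s r. M (Transposition.transpose i j s) r)"
    using assms by (intro ndet_cong) (auto simp: Transposition.transpose_def)
  also have "\<dots> = - ndet N M"
    using assms by (subst ndet_permute_rows) (auto simp: permutes_swap_id sign_swap_id)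
  finally show ?thesis by simp
qed

lemma ndet_identical_cols:
  assumes "i < N" "j < N" "i \<noteq> j" "\<And>s. s < N \<Longrightarrow> M s i = M s j"
  shows "ndet N M = 0"
proof -
  have "ndet N M = ndet N (\<lambda>s r. M s (Transposition.transpose i j r))"
    using assms by (intro ndet_cong) (auto simp: Transposition.transpose_def)
  also have "\<dots> = - ndet N M"
    using assms by (subst ndet_permute_cols) (auto simp: permutes_swap_id sign_swap_id)
  finally show ?thesis by simp
qed

lemma ndet_id: "ndet N (\<lambda>s r. if s = r then 1 else 0) = 1"
proof -
  have "ndet N (\<lambda>s r. if s = r then 1 else 0) = (\<Sum>p | p permutes {..<N}. if p = id then 1 else 0)"
    unfolding ndet_def
  proof (rule sum.cong[OF refl])
    fix p assume p: "p \<in> {p. p permutes {..<N}}"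
    show "of_int (sign p) * (\<Prod>r<N. if p r = r then 1 else 0) = (if p = id then (1::complex) else 0)"
    proof (cases "p = id")
      case False
      then obtain r where "p r \<noteq> r" by (auto simp: fun_eq_iff)
      moreover from this p have "r < N" using permutes_not_in[of p "{..<N}" r] by auto
      ultimately have "(\<Prod>r<N. if p r = r then 1 else (0::complex)) = 0"
        by (intro prod_zero) auto
      then show ?thesis using False by simp
    qed auto
  qed
  then show ?thesis by (simp add: permutes_id sum.delta finite_permutations)
qed

text \<open>\<open>C\<close> consists of the cofactors of row \<open>i\<close>: each permutation
  uses this row in exactly one column, and the Leibniz terms are sorted by that column. What matters
  is that \<open>C\<close> does not depend on \<open>u\<close>.\<close>

lemma ndet_row_linear:
  assumes "i < N"
  obtains C where "\<And>u. ndet N (M(i := u)) = (\<Sum>r<N. C r * u r)"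
proof -
  let ?P = "{p. p permutes {..<N}}"
  define D where "D p r = of_int (sign p) * (\<Prod>r'\<in>{..<N}-{r}. M (p r') r')" for p :: "nat \<Rightarrow> nat" and r
  define C where "C r = (\<Sum>p\<in>?P. if p r = i then D p r else 0)" for r
  have "ndet N (M(i := u)) = (\<Sum>r<N. C r * u r)" for u
  proof -
    have "of_int (sign p) * (\<Prod>r<N. (M(i := u)) (p r) r)
        = (\<Sum>r<N. if p r = i then D p r * u r else 0)" if p: "p \<in> ?P" for p
    proof -
      obtain r where r: "r < N" "p r = i"
        using p assms permutes_image[of p "{..<N}"] by (metis imageE lessThan_iff mem_Collect_eq)
      have inj: "p r' = i \<longleftrightarrow> r' = r" for r'
        using p r by (metis mem_Collect_eq permutes_inj injD)
      have "(\<Prod>r<N. (M(i := u)) (p r) r) = (M(i := u)) (p r) r * (\<Prod>r\<in>{..<N}-{r}. (M(i := u)) (p r) r)"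
        using r by (intro prod.remove) auto
      also have "(\<Prod>r\<in>{..<N}-{r}. (M(i := u)) (p r) r) = (\<Prod>r\<in>{..<N}-{r}. M (p r) r)"
        by (intro prod.cong) (auto simp: inj)
      finally show ?thesis using r by (simp add: inj sum.delta D_def)
    qed
    then have "ndet N (M(i := u)) = (\<Sum>p\<in>?P. \<Sum>r<N. if p r = i then D p r * u r else 0)"
      unfolding ndet_def by (intro sum.cong) auto
    also have "\<dots> = (\<Sum>r<N. \<Sum>p\<in>?P. if p r = i then D p r * u r else 0)"
      by (rule sum.swap)
    also have "\<dots> = (\<Sum>r<N. C r * u r)"
      unfolding C_def sum_distrib_right by (intro sum.cong) auto
    finally show ?thesis .
  qed
  then show thesis by (rule that)
qed

lemma ndet_col_linear:
  assumes "j < N"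
  obtains C where "\<And>u. ndet N (\<lambda>s. (M s)(j := u s)) = (\<Sum>s<N. C s * u s)"
proof -
  let ?P = "{p. p permutes {..<N}}"
  define D where "D p = of_int (sign p) * (\<Prod>r\<in>{..<N}-{j}. M (p r) r)" for p :: "nat \<Rightarrow> nat"
  define C where "C s = (\<Sum>p\<in>?P. if p j = s then D p else 0)" for s
  have "ndet N (\<lambda>s. (M s)(j := u s)) = (\<Sum>s<N. C s * u s)" for u :: "nat \<Rightarrow> complex"
  proof -
    have "of_int (sign p) * (\<Prod>r<N. ((M (p r))(j := u (p r))) r)
        = (\<Sum>s<N. if p j = s then D p * u s else 0)" if p: "p \<in> ?P" for p
    proof -
      have pj: "p j < N" using p assms permutes_in_image[of p "{..<N}" j] by auto
      have "(\<Prod>r<N. ((M (p r))(j := u (p r))) r)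
          = u (p j) * (\<Prod>r\<in>{..<N}-{j}. ((M (p r))(j := u (p r))) r)"
        using assms by (subst prod.remove[of _ j]) auto
      also have "(\<Prod>r\<in>{..<N}-{j}. ((M (p r))(j := u (p r))) r) = (\<Prod>r\<in>{..<N}-{j}. M (p r) r)"
        by (intro prod.cong) auto
      finally show ?thesis using pj by (simp add: sum.delta' D_def)
    qed
    then have "ndet N (\<lambda>s. (M s)(j := u s)) = (\<Sum>p\<in>?P. \<Sum>s<N. if p j = s then D p * u s else 0)"
      unfolding ndet_def by (intro sum.cong) auto
    also have "\<dots> = (\<Sum>s<N. \<Sum>p\<in>?P. if p j = s then D p * u s else 0)"
      by (rule sum.swap)
    also have "\<dots> = (\<Sum>s<N. C s * u s)"
      unfolding C_def sum_distrib_right by (intro sum.cong) auto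
    finally show ?thesis .
  qed
  then show thesis by (rule that)
qed

text \<open>Multilinearity in the columns: column \<open>r\<close> is a combination of the columns
  \<open>Y _ k\<close>, and \<open>g\<close> records the summand taken in each column. Both
  Cauchy-Binet and the change of basis start from this expansion.\<close>

lemma ndet_expand:
  assumes "finite K"
  shows "ndet N (\<lambda>s r. \<Sum>k\<in>K. X r k * Y s k)
    = (\<Sum>g\<in>{..<N} \<rightarrow>\<^sub>E K. (\<Prod>r<N. X r (g r)) * ndet N (\<lambda>s r. Y s (g r)))"
proof -
  have "ndet N (\<lambda>s r. \<Sum>k\<in>K. X r k * Y s k)
     = (\<Sum>p | p permutes {..<N}. of_int (sign p) * (\<Sum>g\<in>{..<N} \<rightarrow>\<^sub>E K. \<Prod>r<N. X r (g r) * Y (p r) (g r)))"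
    unfolding ndet_def by (subst prod_sum_PiE) (auto simp: assms)
  also have "\<dots> = (\<Sum>g\<in>{..<N} \<rightarrow>\<^sub>E K. (\<Prod>r<N. X r (g r)) * ndet N (\<lambda>s r. Y s (g r)))"
    unfolding ndet_def sum_distrib_left
    by (subst sum.swap) (auto intro!: sum.cong simp: prod.distrib mult_ac)
  finally show ?thesis .
qed

section \<open>Sums over index tuples, regrouped by their images\<close>

lemma inj_on_eq_enum_permutes:
  fixes f :: "nat \<Rightarrow> 'a::linorder"
  assumes "inj_on f {..<N}"
  obtains p where "p permutes {..<N}" "\<And>r. r < N \<Longrightarrow> f r = sorted_list_of_set (f ` {..<N}) ! p r"
proof -
  let ?l = "sorted_list_of_set (f ` {..<N})"
  define p where "p r = (if r < N then inv_into {..<N} ((!) ?l) (f r) else r)" for r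
  have len: "length ?l = N"
    using assms by (simp add: card_image)
  have bij: "bij_betw ((!) ?l) {..<N} (f ` {..<N})"
    using len by (intro bij_betw_nth) auto
  have eq: "f r = ?l ! p r" if "r < N" for r
    using that bij by (simp add: p_def bij_betw_inv_into_right)
  have "bij_betw (inv_into {..<N} ((!) ?l) \<circ> f) {..<N} {..<N}"
    using bij_betw_inv_into[OF bij] assms by (intro bij_betw_trans[of f _ "f ` {..<N}"]) (auto simp: bij_betw_def)
  then have "bij_betw p {..<N} {..<N}"
    by (rule bij_betw_cong[THEN iffD1, rotated]) (auto simp: p_def)
  then have "p permutes {..<N}"
    by (rule bij_imp_permutes) (auto simp: p_def)
  with eq show thesis by (intro that)
qed

text \<open>An injective \<open>g\<close> amounts to its image \<open>J\<close> together with the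
  permutation that sorts it; the others contribute nothing. This is the combinatorial half of
  Cauchy-Binet. The hypothesis \<open>cong\<close> bridges the gap between members of the function
  space, which are \<open>undefined\<close> outside \<open>{..<N}\<close>, and enumerations, which
  are not restricted.\<close>

lemma sum_PiE_group_image:
  fixes K :: "'a::linorder set" and h :: "(nat \<Rightarrow> 'a) \<Rightarrow> 'b::comm_monoid_add"
  assumes "finite K"
    and noninj: "\<And>g. g \<in> {..<N} \<rightarrow>\<^sub>E K \<Longrightarrow> \<not> inj_on g {..<N} \<Longrightarrow> h g = 0"
    and cong: "\<And>g g'. (\<And>r. r < N \<Longrightarrow> g r = g' r) \<Longrightarrow> h g = h g'"
  shows "(\<Sum>g\<in>{..<N} \<rightarrow>\<^sub>E K. h g)
    = (\<Sum>J | J \<subseteq> K \<and> card J = N. \<Sum>p | p permutes {..<N}. h (\<lambda>r. sorted_list_of_set J ! p r))"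
proof -
  let ?G = "{g \<in> {..<N} \<rightarrow>\<^sub>E K. inj_on g {..<N}}"
  let ?S = "{J. J \<subseteq> K \<and> card J = N}"
  let ?P = "{p. p permutes {..<N}}"
  have fG: "finite ?G" using assms(1) by (simp add: finite_PiE)
  have fS: "finite ?S" using assms(1) by simp
  have "(\<Sum>g\<in>{..<N} \<rightarrow>\<^sub>E K. h g) = sum h ?G"
    using assms(1) noninj by (intro sum.mono_neutral_right) (auto intro!: finite_PiE)
  also have "\<dots> = (\<Sum>J\<in>?S. sum h {g \<in> ?G. g ` {..<N} = J})"
  proof (rule sum.group[OF fG fS, symmetric])
    show "(\<lambda>g. g ` {..<N}) ` ?G \<subseteq> ?S"
      using card_image[of _ "{..<N}"] by (fastforce simp: PiE_def Pi_def)
  qed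
  also have "\<dots> = (\<Sum>J\<in>?S. \<Sum>p\<in>?P. h (\<lambda>r. sorted_list_of_set J ! p r))"
  proof (rule sum.cong[OF refl])
    fix J assume J: "J \<in> ?S"
    then have fJ: "finite J" using assms(1) finite_subset by blast
    let ?l = "sorted_list_of_set J"
    define F where "F p = restrict (\<lambda>r. ?l ! p r) {..<N}" for p :: "nat \<Rightarrow> nat"
    have bij: "bij_betw ((!) ?l) {..<N} J"
      using J fJ by (intro bij_betw_nth) auto
    have bp: "bij_betw (\<lambda>r. ?l ! p r) {..<N} J" if "p \<in> ?P" for p
      using bij_betw_trans[OF permutes_imp_bij bij, of p] that by (simp add: o_def)
    have "bij_betw F ?P {g \<in> ?G. g ` {..<N} = J}"
    proof (intro bij_betwI')
      fix p q assume p: "p \<in> ?P" and q: "q \<in> ?P"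
      show "(F p = F q) = (p = q)"
      proof
        assume "F p = F q"
        have "p r = q r" for r
        proof (cases "r < N")
          case True
          then have "?l ! p r = ?l ! q r" using \<open>F p = F q\<close> by (metis F_def lessThan_iff restrict_apply')
          moreover have "p r < N" "q r < N"
            using p q True permutes_in_image[of p "{..<N}" r] permutes_in_image[of q "{..<N}" r] by auto
          ultimately show ?thesis using bij by (auto simp: bij_betw_def inj_on_def)
        next
          case False
          then show ?thesis using p q by (metis lessThan_iff mem_Collect_eq permutes_not_in)
        qed
        then show "p = q" by auto
      qed simp
    next
      fix p assume p: "p \<in> ?P"
      have "inj_on (F p) {..<N}" "F p ` {..<N} = J"
        using bp[OF p] by (auto simp: bij_betw_def F_def inj_on_def)
      moreover have "F p \<in> {..<N} \<rightarrow>\<^sub>E K"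
        using bp[OF p] J by (auto simp: F_def bij_betw_def)
      ultimately show "F p \<in> {g \<in> ?G. g ` {..<N} = J}" by auto
    next
      fix g assume g: "g \<in> {g \<in> ?G. g ` {..<N} = J}"
      then obtain p where p: "p permutes {..<N}" "\<And>r. r < N \<Longrightarrow> g r = ?l ! p r"
        using inj_on_eq_enum_permutes[of g N] by auto
      have "g = F p"
        using g p(2) by (auto simp: F_def restrict_def fun_eq_iff PiE_def extensional_def)
      with p(1) show "\<exists>p\<in>?P. g = F p" by auto
    qed
    then have "sum h {g \<in> ?G. g ` {..<N} = J} = (\<Sum>p\<in>?P. h (F p))"
      by (rule sum.reindex_bij_betw[symmetric])
    also have "\<dots> = (\<Sum>p\<in>?P. h (\<lambda>r. ?l ! p r))"
      by (intro sum.cong refl cong) (simp add: F_def)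
    finally show "sum h {g \<in> ?G. g ` {..<N} = J} = (\<Sum>p\<in>?P. h (\<lambda>r. ?l ! p r))" .
  qed
  finally show ?thesis .
qed

section \<open>Pluecker vectors and exterior powers\<close>

text \<open>A Pluecker coordinate for an arbitrary tuple \<open>f\<close> of rows, unsorted or with
  repetitions. Cramer's rule in \<open>nf\<close> replaces one row of a sorted tuple and so leaves
  the range of \<open>plucker\<close>. The order \<open>Suc n\<close> is a number unrelated to the
  index type, hence determinants indexed by naturals.\<close>

definition tdet :: "nat \<Rightarrow> (nat \<Rightarrow> 'k::finite cvec) \<Rightarrow> (nat \<Rightarrow> 'k) \<Rightarrow> complex" where
  "tdet n b f = ndet (Suc n) (\<lambda>s r. b s $ f r)"

definition plv :: "nat \<Rightarrow> (nat \<Rightarrow> 'k::{finite,linorder} cvec) \<Rightarrow> (complex, 'k set) vec" where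
  "plv n b = (\<chi> I. if I \<in> psets n then plucker n b I else 0)"

text \<open>The matrix of \<Lambda>^(n+1) A. As in \<open>plv\<close>, indices outside
  \<open>psets n\<close> are padded with 0, so that linear algebra and topology over the finite type
  \<open>'k set\<close> apply. In consequence \<open>hat n (mat 1)\<close> is a projection, not the
  identity.\<close>

definition hat :: "nat \<Rightarrow> 'k::{finite,linorder} cmat \<Rightarrow> 'k set cmat" where
  "hat n A = (\<chi> I J. if I \<in> psets n \<and> J \<in> psets n then minor (Suc n) A I J else 0)"

abbreviation enum_set :: "'a::linorder set \<Rightarrow> nat \<Rightarrow> 'a" where
  "enum_set I \<equiv> (!) (sorted_list_of_set I)"

lemma plucker_eq_tdet: "plucker n b I = tdet n b (enum_set I)"
  by (simp add: plucker_def tdet_def ndet_def)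

lemma minor_eq_plucker: "minor (Suc n) A I J = plucker n (\<lambda>s. column (enum_set J s) A) I"
  by (simp add: minor_def plucker_def column_def)

lemma inj_on_enum_set:
  "I \<in> psets n \<Longrightarrow> inj_on (enum_set I) {..<Suc n}"
  for I :: "'k::{finite,linorder} set"
  by (auto simp: psets_def inj_on_def nth_eq_iff_index_eq)

lemma tdet_permute:
  assumes "p permutes {..<Suc n}" "\<And>r. r < Suc n \<Longrightarrow> g r = f (p r)"
  shows "tdet n b g = of_int (sign p) * tdet n b f"
proof -
  have "tdet n b g = ndet (Suc n) (\<lambda>s r. b s $ f (p r))"
    unfolding tdet_def using assms(2) by (intro ndet_cong) auto
  then show ?thesis
    using ndet_permute_cols[OF assms(1), of "\<lambda>s r. b s $ f r"] by (simp add: tdet_def)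
qed

lemma tdet_not_inj:
  assumes "\<not> inj_on f {..<Suc n}"
  shows "tdet n b f = 0"
proof -
  obtain i j where "i < Suc n" "j < Suc n" "i \<noteq> j" "f i = f j"
    using assms by (auto simp: inj_on_def)
  then show ?thesis unfolding tdet_def by (intro ndet_identical_cols[of i _ j]) auto
qed

text \<open>\<open>plv\<close> records increasing tuples only; sorting with a sign carries the
  proportionality to all injective tuples, and repetitions give 0 on both sides.\<close>

lemma tdet_scale:
  assumes "plv n b = c *s plv n b'"
  shows "tdet n b f = c * tdet n b' f"
proof (cases "inj_on f {..<Suc n}")
  case True
  let ?J = "f ` {..<Suc n}"
  obtain p where p: "p permutes {..<Suc n}" "\<And>r. r < Suc n \<Longrightarrow> f r = enum_set ?J (p r)"
    using inj_on_eq_enum_permutes[OF True] by blast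
  have "?J \<in> psets n" using True by (simp add: psets_def card_image)
  moreover have "plv n b $ ?J = c * plv n b' $ ?J" by (simp add: assms)
  ultimately have "tdet n b (enum_set ?J) = c * tdet n b' (enum_set ?J)"
    by (simp add: plv_def plucker_eq_tdet)
  then show ?thesis by (simp add: tdet_permute[where f = "enum_set ?J" and g = f, OF p])
qed (simp add: tdet_not_inj)

lemma tdet_linear:
  assumes "s < Suc n"
  obtains C where "\<And>v. tdet n (b(s := v)) f = (\<Sum>r<Suc n. C r * v $ f r)"
proof -
  obtain C where C: "\<And>u. ndet (Suc n) ((\<lambda>s r. b s $ f r)(s := u)) = (\<Sum>r<Suc n. C r * u r)"
    using ndet_row_linear[OF assms] by blast
  have "tdet n (b(s := v)) f = (\<Sum>r<Suc n. C r * v $ f r)" for v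
  proof -
    have "(\<lambda>t r. (b(s := v)) t $ f r) = (\<lambda>t r. b t $ f r)(s := \<lambda>r. v $ f r)"
      by (auto simp: fun_eq_iff)
    then show ?thesis by (simp only: tdet_def C)
  qed
  then show thesis by (rule that)
qed

lemma tdet_identical:
  assumes "s < Suc n" "t < Suc n" "s \<noteq> t" "b s = b t"
  shows "tdet n b f = 0"
  unfolding tdet_def using assms by (intro ndet_identical_rows[of s _ t]) auto

lemma plv_sum:
  assumes s: "s < Suc n" and "finite T"
  shows "plv n (b(s := (\<Sum>t\<in>T. a t *s v t))) = (\<Sum>t\<in>T. a t *s plv n (b(s := v t)))"
proof -
  have "tdet n (b(s := (\<Sum>t\<in>T. a t *s v t))) f = (\<Sum>t\<in>T. a t * tdet n (b(s := v t)) f)" for f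
  proof -
    obtain C where C: "\<And>v. tdet n (b(s := v)) f = (\<Sum>r<Suc n. C r * v $ f r)"
      using tdet_linear[OF s] by blast
    show ?thesis
      by (simp only: C sum_component vector_smult_component sum_distrib_left)
         (subst sum.swap, auto intro!: sum.cong simp: mult_ac)
  qed
  then show ?thesis
    by (simp add: vec_eq_iff plv_def plucker_eq_tdet)
qed

lemma plv_lincomb2:
  assumes "s < Suc n"
  shows "plv n (b(s := x *s u + y *s w)) = x *s plv n (b(s := u)) + y *s plv n (b(s := w))"
  using plv_sum[OF assms, of "{0, 1::nat}" b "\<lambda>t. if t = 0 then x else y" "\<lambda>t. if t = 0 then u else w"]
  by simp

lemma plv_identical:
  assumes "s < Suc n" "t < Suc n" "s \<noteq> t" "b s = b t"
  shows "plv n b = 0"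
  by (simp add: vec_eq_iff plv_def plucker_eq_tdet tdet_identical[OF assms])

text \<open>By linearity in entry \<open>s\<close>: every term with \<open>t\<close> different from
  \<open>s\<close> repeats a vector and vanishes.\<close>

lemma plv_upd_lincomb:
  assumes s: "s < Suc n"
  shows "plv n (b(s := (\<Sum>t<Suc n. a t *s b t))) = a s *s plv n b"
proof -
  have "plv n (b(s := (\<Sum>t<Suc n. a t *s b t))) = (\<Sum>t<Suc n. a t *s plv n (b(s := b t)))"
    by (rule plv_sum[OF s]) simp
  also have "\<dots> = (\<Sum>t<Suc n. if t = s then a s *s plv n b else 0)"
  proof (rule sum.cong[OF refl])
    fix t assume "t \<in> {..<Suc n}"
    then show "a t *s plv n (b(s := b t)) = (if t = s then a s *s plv n b else 0)"
      using plv_identical[of s n t "b(s := b t)"] s by auto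
  qed
  finally show ?thesis using s by (simp del: sum.lessThan_Suc)
qed

lemma tdet_cong: "(\<And>s r. s < Suc n \<Longrightarrow> r < Suc n \<Longrightarrow> b s $ f r = b' s $ f' r) \<Longrightarrow> tdet n b f = tdet n b' f'"
  unfolding tdet_def by (rule ndet_cong) auto

lemma plv_cong: "(\<And>s. s < Suc n \<Longrightarrow> b s = b' s) \<Longrightarrow> plv n b = plv n b'"
  by (simp add: vec_eq_iff plv_def plucker_eq_tdet cong: tdet_cong)

text \<open>Cauchy-Binet, read as the action of \<Lambda>^(n+1) A on decomposable vectors. Expanding
  all columns gives a sum over index tuples, and grouping these by image produces the minors of
  \<open>A\<close>.\<close>

lemma cauchy_binet_plv: "plv n (\<lambda>s. A *v b s) = hat n A *v plv n b"
proof -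
  have "plucker n (\<lambda>s. A *v b s) I = (\<Sum>J\<in>psets n. minor (Suc n) A I J * plucker n b J)" for I
  proof -
    let ?E = "enum_set I"
    have "plucker n (\<lambda>s. A *v b s) I = ndet (Suc n) (\<lambda>s r. \<Sum>k\<in>UNIV. A $ ?E r $ k * b s $ k)"
      by (simp add: plucker_eq_tdet tdet_def matrix_vector_mult_def)
    also have "\<dots> = (\<Sum>g\<in>{..<Suc n} \<rightarrow>\<^sub>E UNIV. (\<Prod>r<Suc n. A $ ?E r $ g r) * tdet n b g)"
      unfolding tdet_def by (rule ndet_expand) simp
    also have "\<dots> = (\<Sum>J | J \<subseteq> UNIV \<and> card J = Suc n. \<Sum>p | p permutes {..<Suc n}.
        (\<Prod>r<Suc n. A $ ?E r $ enum_set J (p r)) * tdet n b (\<lambda>r. enum_set J (p r)))"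
    proof (rule sum_PiE_group_image)
      fix g g' :: "nat \<Rightarrow> 'a" assume "\<And>r. r < Suc n \<Longrightarrow> g r = g' r"
      then show "(\<Prod>r<Suc n. A $ ?E r $ g r) * tdet n b g = (\<Prod>r<Suc n. A $ ?E r $ g' r) * tdet n b g'"
        by (intro arg_cong2[where f = "(*)"] prod.cong tdet_cong) auto
    qed (auto simp: tdet_not_inj)
    also have "\<dots> = (\<Sum>J\<in>psets n. minor (Suc n) A I J * plucker n b J)"
      unfolding minor_def sum_distrib_right
      by (intro sum.cong) (auto simp: psets_def tdet_permute plucker_eq_tdet simp del: prod.lessThan_Suc)
    finally show ?thesis .
  qed
  moreover have "(\<Sum>J\<in>UNIV. hat n A $ I $ J * plv n b $ J) = (\<Sum>J\<in>psets n. hat n A $ I $ J * plv n b $ J)" for I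
    by (intro sum.mono_neutral_right) (auto simp: plv_def)
  ultimately show ?thesis
    by (simp add: vec_eq_iff matrix_vector_mult_def plv_def hat_def)
qed

text \<open>The columns of \<open>hat n (A ** B)\<close> are Pluecker vectors of tuples of columns
  of \<open>A ** B\<close>, that is, of images under \<open>A\<close>; so
  \<open>cauchy_binet_plv\<close> applies column by column.\<close>

lemma hat_mult: "hat n (A ** B) = hat n A ** hat n B"
proof -
  have "hat n (A ** B) $ I $ J = (hat n A ** hat n B) $ I $ J" for I J
  proof (cases "I \<in> psets n \<and> J \<in> psets n")
    case True
    let ?b = "\<lambda>s. column (enum_set J s) B"
    have "column j (A ** B) = A *v column j B" for j
      by (simp add: vec_eq_iff column_def matrix_matrix_mult_def matrix_vector_mult_def)
    then have "hat n (A ** B) $ I $ J = plv n (\<lambda>s. A *v ?b s) $ I"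
      using True by (simp add: hat_def minor_eq_plucker plv_def)
    also have "\<dots> = (hat n A *v plv n ?b) $ I"
      by (simp add: cauchy_binet_plv)
    also have "\<dots> = (hat n A ** hat n B) $ I $ J"
      using True by (auto simp: matrix_vector_mult_def matrix_matrix_mult_def plv_def hat_def minor_eq_plucker intro!: sum.cong)
    finally show ?thesis .
  next
    case False
    then show ?thesis by (auto simp: hat_def matrix_matrix_mult_def intro!: sum.neutral)
  qed
  then show ?thesis by (simp add: vec_eq_iff)
qed

text \<open>The expansion behind Cauchy-Binet, now with just n+1 summation indices: there is only
  one subset of full size, so a single determinant factors out and all coordinates change by the
  same factor.\<close>

lemma tdet_basis_change:
  assumes "\<And>s. s < Suc n \<Longrightarrow> b' s = (\<Sum>t<Suc n. c s t *s b t)"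
  shows "tdet n b' f = ndet (Suc n) c * tdet n b f"
proof -
  have "tdet n b' f = ndet (Suc n) (\<lambda>s r. \<Sum>t\<in>{..<Suc n}. b t $ f r * c s t)"
    unfolding tdet_def by (intro ndet_cong) (simp add: assms mult_ac)
  also have "\<dots> = (\<Sum>g\<in>{..<Suc n} \<rightarrow>\<^sub>E {..<Suc n}. (\<Prod>r<Suc n. b (g r) $ f r) * ndet (Suc n) (\<lambda>s r. c s (g r)))"
    by (rule ndet_expand) simp
  also have "\<dots> = (\<Sum>J | J \<subseteq> {..<Suc n} \<and> card J = Suc n. \<Sum>p | p permutes {..<Suc n}.
        (\<Prod>r<Suc n. b (enum_set J (p r)) $ f r) * ndet (Suc n) (\<lambda>s r. c s (enum_set J (p r))))"
  proof (rule sum_PiE_group_image)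
    fix g g' :: "nat \<Rightarrow> nat" assume "\<And>r. r < Suc n \<Longrightarrow> g r = g' r"
    then show "(\<Prod>r<Suc n. b (g r) $ f r) * ndet (Suc n) (\<lambda>s r. c s (g r))
        = (\<Prod>r<Suc n. b (g' r) $ f r) * ndet (Suc n) (\<lambda>s r. c s (g' r))"
      by (intro arg_cong2[where f = "(*)"] prod.cong ndet_cong) auto
  next
    fix g :: "nat \<Rightarrow> nat" assume "\<not> inj_on g {..<Suc n}"
    then obtain i j where "i < Suc n" "j < Suc n" "i \<noteq> j" "g i = g j" by (auto simp: inj_on_def)
    then have "ndet (Suc n) (\<lambda>s r. c s (g r)) = 0" by (intro ndet_identical_cols[of i _ j]) auto
    then show "(\<Prod>r<Suc n. b (g r) $ f r) * ndet (Suc n) (\<lambda>s r. c s (g r)) = 0" by simp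
  qed simp
  also have "{J. J \<subseteq> {..<Suc n} \<and> card J = Suc n} = {{..<Suc n}}"
    using card_subset_eq[of "{..<Suc n}"] by auto
  also have "(\<Sum>J\<in>{{..<Suc n}}. \<Sum>p | p permutes {..<Suc n}.
        (\<Prod>r<Suc n. b (enum_set J (p r)) $ f r) * ndet (Suc n) (\<lambda>s r. c s (enum_set J (p r))))
      = (\<Sum>p | p permutes {..<Suc n}. (\<Prod>r<Suc n. b (p r) $ f r) * (of_int (sign p) * ndet (Suc n) c))"
  proof -
    have l: "sorted_list_of_set {..<Suc n} = [0..<Suc n]"
      by (metis lessThan_atLeast0 sorted_list_of_set_range)
    have "(\<Prod>r<Suc n. b (enum_set {..<Suc n} (p r)) $ f r) * ndet (Suc n) (\<lambda>s r. c s (enum_set {..<Suc n} (p r)))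
      = (\<Prod>r<Suc n. b (p r) $ f r) * (of_int (sign p) * ndet (Suc n) c)" if p: "p permutes {..<Suc n}" for p
    proof -
      have e: "enum_set {..<Suc n} (p r) = p r" if "r < Suc n" for r
        using permutes_in_image[OF p, of r] that unfolding l by (auto simp del: upt_Suc)
      have "ndet (Suc n) (\<lambda>s r. c s (enum_set {..<Suc n} (p r))) = ndet (Suc n) (\<lambda>s r. c s (p r))"
        by (intro ndet_cong) (simp only: e)
      also have "\<dots> = of_int (sign p) * ndet (Suc n) c" by (rule ndet_permute_cols[OF p])
      finally have "ndet (Suc n) (\<lambda>s r. c s (enum_set {..<Suc n} (p r))) = of_int (sign p) * ndet (Suc n) c" .
      moreover have "(\<Prod>r<Suc n. b (enum_set {..<Suc n} (p r)) $ f r) = (\<Prod>r<Suc n. b (p r) $ f r)"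
        by (intro prod.cong) (simp_all only: e lessThan_iff)
      ultimately show ?thesis by simp
    qed
    then show ?thesis
      by (subst sum.insert) (auto intro!: sum.cong simp del: prod.lessThan_Suc sorted_list_of_set_lessThan_Suc)
  qed
  also have "\<dots> = ndet (Suc n) c * tdet n b f"
    unfolding tdet_def ndet_def[of _ "\<lambda>s r. b s $ f r"] sum_distrib_left
    by (intro sum.cong) (auto simp: mult_ac simp del: prod.lessThan_Suc)
  finally show ?thesis .
qed

section \<open>Limits of n-planes\<close>

definition pspan :: "nat \<Rightarrow> (nat \<Rightarrow> 'k::finite cvec) \<Rightarrow> 'k cvec set" where
  "pspan n b = {v. \<exists>a. v = (\<Sum>s<Suc n. a s *s b s)}"

lemma pspan_eq_span: "pspan n b = vec.span (b ` {..<Suc n})"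
proof
  show "pspan n b \<subseteq> vec.span (b ` {..<Suc n})"
    unfolding pspan_def
    by (clarify, rule vec.span_sum, rule vec.span_scale, rule vec.span_base) auto
  have "vec.subspace (pspan n b)"
  proof (rule vec.subspaceI)
    show "0 \<in> pspan n b" unfolding pspan_def by (auto intro!: exI[of _ "\<lambda>_. 0"])
    show "x + y \<in> pspan n b" if "x \<in> pspan n b" "y \<in> pspan n b" for x y
    proof -
      from that obtain a a' where "x = (\<Sum>s<Suc n. a s *s b s)" "y = (\<Sum>s<Suc n. a' s *s b s)"
        by (auto simp: pspan_def)
      then have "x + y = (\<Sum>s<Suc n. (a s + a' s) *s b s)"
        by (simp only: vector_sadd_rdistrib sum.distrib)
      then show ?thesis unfolding pspan_def by (intro CollectI exI)
    qed
    show "c *s x \<in> pspan n b" if "x \<in> pspan n b" for c x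
    proof -
      from that obtain a where "x = (\<Sum>s<Suc n. a s *s b s)"
        by (auto simp: pspan_def)
      then have "c *s x = (\<Sum>s<Suc n. (c * a s) *s b s)"
        by (simp only: vec.scale_sum_right vector_smult_assoc)
      then show ?thesis unfolding pspan_def by (intro CollectI exI)
    qed
  qed
  moreover have "b s \<in> pspan n b" if s: "s < Suc n" for s
  proof -
    have "b s = (\<Sum>t<Suc n. (if t = s then 1 else 0) *s b t)"
      using s by (simp add: if_distrib[of "\<lambda>x. x *s _"] sum.delta' cong: if_cong del: sum.lessThan_Suc)
    then show ?thesis unfolding pspan_def by (intro CollectI exI)
  qed
  ultimately show "vec.span (b ` {..<Suc n}) \<subseteq> pspan n b"
    by (intro vec.span_minimal) auto
qed

lemma subspace_pspan: "vec.subspace (pspan n b)"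
  by (simp add: pspan_eq_span)

lemma pspan_base: "s < Suc n \<Longrightarrow> b s \<in> pspan n b"
  by (simp add: pspan_eq_span vec.span_base)

lemma mem_plane_pts_iff: "x \<noteq> 0 \<Longrightarrow> ppt x \<in> plane_pts n b \<longleftrightarrow> x \<in> pspan n b"
  for x :: "'k::finite cvec"
proof
  assume "x \<noteq> 0" and "ppt x \<in> plane_pts n b"
  then obtain v where v: "ppt x = ppt v" "v \<in> pspan n b"
    by (auto simp: plane_pts_def pspan_def)
  have "x \<in> ppt x" unfolding ppt_def by (auto intro!: exI[of _ 1])
  then obtain c where "x = c *s v" using v(1) by (auto simp: ppt_def)
  then show "x \<in> pspan n b" using v(2) subspace_pspan vec.subspace_scale by blast
next
  assume "x \<noteq> 0" and "x \<in> pspan n b"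
  then show "ppt x \<in> plane_pts n b" by (auto simp: plane_pts_def pspan_def)
qed

lemma nplane_basis_inj_independent:
  fixes b :: "nat \<Rightarrow> 'k::finite cvec"
  assumes "nplane_basis n b"
  shows "inj_on b {..<Suc n}" "vec.independent (b ` {..<Suc n})"
proof -
  have *: "a s = 0" if "(\<Sum>s<Suc n. a s *s b s) = 0" "s < Suc n" for a s
    using assms that unfolding nplane_basis_def by blast
  show inj: "inj_on b {..<Suc n}"
  proof (rule inj_onI, rule ccontr)
    fix i j assume ij: "i \<in> {..<Suc n}" "j \<in> {..<Suc n}" "b i = b j" "i \<noteq> j"
    \<comment> \<open>The coefficients of the relation \<open>b i - b j = 0\<close>.\<close>
    define a :: "nat \<Rightarrow> complex" where "a s = (if s = i then 1 else 0) - (if s = j then 1 else 0)" for s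
    have "(\<Sum>s<Suc n. a s *s b s)
        = (\<Sum>s<Suc n. if s = i then b i else 0) - (\<Sum>s<Suc n. if s = j then b j else 0)"
      unfolding sum_subtractf[symmetric] by (rule sum.cong) (auto simp: a_def)
    also have "\<dots> = 0" using ij by (simp del: sum.lessThan_Suc)
    finally have "a i = 0" using *[of a i] ij by simp
    then show False using ij by (simp add: a_def)
  qed
  show "vec.independent (b ` {..<Suc n})"
  proof (rule vec.independent_if_scalars_zero)
    fix f x assume sum: "(\<Sum>x\<in>b ` {..<Suc n}. f x *s x) = 0" and x: "x \<in> b ` {..<Suc n}"
    from sum have "(\<Sum>s<Suc n. f (b s) *s b s) = 0"
      by (subst (asm) sum.reindex[OF inj]) (simp add: o_def)
    then show "f x = 0" using *[of "f \<circ> b"] x by auto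
  qed simp
qed

lemma dim_pspan: "nplane_basis n b \<Longrightarrow> vec.dim (pspan n b) = Suc n"
  using nplane_basis_inj_independent[of n b]
  by (simp add: pspan_eq_span vec.dim_eq_card_independent card_image)

lemma dim_pspan_le: "vec.dim (pspan n b) \<le> Suc n"
  unfolding pspan_eq_span vec.dim_span
  using vec.dim_le_card'[of "b ` {..<Suc n}"] card_image_le[of "{..<Suc n}" b] by simp

lemma nplane_basisI_dim:
  fixes b :: "nat \<Rightarrow> 'k::finite cvec"
  assumes "vec.dim (pspan n b) = Suc n"
  shows "nplane_basis n b"
  unfolding nplane_basis_def
proof (intro allI impI, rule ccontr)
  fix a s assume eq: "(\<Sum>s<Suc n. a s *s b s) = 0" and s: "s < Suc n" and "a s \<noteq> 0"
  have "(\<Sum>t<Suc n. a t *s b t) = a s *s b s + (\<Sum>t\<in>{..<Suc n}-{s}. a t *s b t)"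
    using s by (intro sum.remove) auto
  with eq have "a s *s b s = - (\<Sum>t\<in>{..<Suc n}-{s}. a t *s b t)"
    by (simp add: eq_neg_iff_add_eq_0)
  moreover have "b s = inverse (a s) *s (a s *s b s)"
    using \<open>a s \<noteq> 0\<close> by (simp add: vec_eq_iff)
  ultimately have "b s = inverse (a s) *s - (\<Sum>t\<in>{..<Suc n}-{s}. a t *s b t)"
    by metis
  also have "\<dots> \<in> vec.span (b ` ({..<Suc n}-{s}))"
    by (rule vec.span_scale, rule vec.span_neg, rule vec.span_sum, rule vec.span_scale, rule vec.span_base) auto
  finally have bs: "b s \<in> vec.span (b ` ({..<Suc n}-{s}))" .
  have "b ` {..<Suc n} \<subseteq> vec.span (b ` ({..<Suc n}-{s}))"
  proof
    fix x assume "x \<in> b ` {..<Suc n}"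
    then obtain t where "t < Suc n" "x = b t" by auto
    then show "x \<in> vec.span (b ` ({..<Suc n}-{s}))"
      using bs by (cases "t = s") (auto intro: vec.span_base)
  qed
  then have "vec.dim (b ` {..<Suc n}) \<le> card (b ` ({..<Suc n}-{s}))"
    by (intro vec.dim_le_card) auto
  also have "\<dots> \<le> card ({..<Suc n}-{s})" by (rule card_image_le) simp
  also have "\<dots> < Suc n" using s by simp
  finally show False using assms by (simp add: pspan_eq_span)
qed

text \<open>The reduced basis of the span of b, with identity block in the rows I (Cramer's rule). It depends
  only on ratios of Pluecker coordinates, so it converges when those do.\<close>
definition nf :: "nat \<Rightarrow> (nat \<Rightarrow> 'k::{finite,linorder} cvec) \<Rightarrow> 'k set \<Rightarrow> nat \<Rightarrow> 'k cvec" where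
  "nf n b I s = (\<chi> k. tdet n b ((enum_set I)(s := k)) / plucker n b I)"

lemma nf_enum:
  assumes "plucker n b I \<noteq> 0" "s < Suc n" "r < Suc n"
  shows "nf n b I s $ enum_set I r = (if s = r then 1 else 0)"
proof (cases "s = r")
  case True
  then show ?thesis using assms by (simp add: nf_def plucker_eq_tdet)
next
  case False
  then have "\<not> inj_on ((enum_set I)(s := enum_set I r)) {..<Suc n}"
    using assms by (auto simp: inj_on_def)
  then show ?thesis using False by (simp add: nf_def tdet_not_inj)
qed

lemma sum_nf_enum:
  assumes "plucker n b I \<noteq> 0" "r < Suc n"
  shows "(\<Sum>s<Suc n. a s *s nf n b I s) $ enum_set I r = a r"
proof -
  have "(\<Sum>s<Suc n. a s *s nf n b I s) $ enum_set I r = (\<Sum>s<Suc n. if s = r then a r else 0)"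
    unfolding sum_component
    by (rule sum.cong) (auto simp: nf_enum[OF assms(1) _ assms(2)])
  then show ?thesis using assms(2) by (simp del: sum.lessThan_Suc)
qed

text \<open>Cofactor expansion along the replaced column: the cofactors do not depend on the row
  \<open>k\<close> put there, so they are, up to the common denominator, the coefficients of
  \<open>nf n b I s\<close> in terms of \<open>b\<close>.\<close>

lemma nf_mem_pspan:
  assumes "s < Suc n"
  shows "nf n b I s \<in> pspan n b"
proof -
  let ?E = "enum_set I"
  obtain C where C: "\<And>u. ndet (Suc n) (\<lambda>t. ((\<lambda>r. b t $ ?E r))(s := u t)) = (\<Sum>t<Suc n. C t * u t)"
    using ndet_col_linear[OF assms, of "\<lambda>t r. b t $ ?E r"] by blast
  have "tdet n b (?E(s := k)) = (\<Sum>t<Suc n. C t * b t $ k)" for k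
  proof -
    have "(\<lambda>t r. b t $ (?E(s := k)) r) = (\<lambda>t. (\<lambda>r. b t $ ?E r)(s := b t $ k))"
      by (auto simp: fun_eq_iff)
    then show ?thesis by (simp only: tdet_def C)
  qed
  then have "nf n b I s = (\<Sum>t<Suc n. (C t / plucker n b I) *s b t)"
    by (simp add: vec_eq_iff nf_def sum_divide_distrib add_divide_distrib)
  then show ?thesis unfolding pspan_def by (intro CollectI exI)
qed

lemma pspan_nf_subset: "pspan n (nf n b I) \<subseteq> pspan n b"
  unfolding pspan_eq_span[of n "nf n b I"]
  by (intro vec.span_minimal subspace_pspan) (auto intro: nf_mem_pspan)

lemma nplane_basis_nf:
  assumes "plucker n b I \<noteq> 0"
  shows "nplane_basis n (nf n b I)"
  unfolding nplane_basis_def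
proof (intro allI impI)
  fix a s assume "(\<Sum>s<Suc n. a s *s nf n b I s) = 0" "s < Suc n"
  then show "a s = 0" using sum_nf_enum[OF assms, of s a] by simp
qed

lemma pspan_nf:
  assumes "plucker n b I \<noteq> 0"
  shows "pspan n (nf n b I) = pspan n b"
  using dim_pspan[OF nplane_basis_nf[OF assms]] dim_pspan_le[of n b]
  by (intro vec.subspace_dim_equal subspace_pspan pspan_nf_subset) simp

text \<open>The span of \<open>b\<close> contains the n+1 independent vectors
  \<open>nf n b I s\<close>, and this dimension leaves no room for a relation in
  \<open>b\<close>.\<close>

lemma nplane_basis_if_plucker_nonzero:
  assumes "plucker n b I \<noteq> 0"
  shows "nplane_basis n b"
  using dim_pspan[OF nplane_basis_nf[OF assms]] by (intro nplane_basisI_dim) (simp add: pspan_nf[OF assms])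

text \<open>Because of the identity block, the entries of \<open>x\<close> in the rows
  \<open>I\<close> are its only possible coefficients. Membership thus becomes an equation in
  \<open>x\<close> and ratios of Pluecker coordinates, which passes to limits.\<close>

lemma mem_pspan_iff_nf:
  assumes "plucker n b I \<noteq> 0"
  shows "x \<in> pspan n b \<longleftrightarrow> x = (\<Sum>s<Suc n. x $ enum_set I s *s nf n b I s)"
proof
  assume "x \<in> pspan n b"
  then obtain a where a: "x = (\<Sum>s<Suc n. a s *s nf n b I s)"
    unfolding pspan_nf[OF assms, symmetric] by (auto simp: pspan_def)
  have "x $ enum_set I s = a s" if "s < Suc n" for s
    unfolding a by (rule sum_nf_enum[OF assms that])
  then have "(\<Sum>s<Suc n. x $ enum_set I s *s nf n b I s) = (\<Sum>s<Suc n. a s *s nf n b I s)"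
    by (intro sum.cong) auto
  then show "x = (\<Sum>s<Suc n. x $ enum_set I s *s nf n b I s)" using a by simp
next
  assume "x = (\<Sum>s<Suc n. x $ enum_set I s *s nf n b I s)"
  then have "x \<in> pspan n (nf n b I)" unfolding pspan_def by (intro CollectI exI)
  then show "x \<in> pspan n b" by (simp add: pspan_nf[OF assms])
qed

text \<open>The change to the reduced basis multiplies every coordinate by one determinant, and its
  value is read off at \<open>I\<close>, where the reduced basis has the identity block.\<close>

lemma tdet_nf:
  assumes "plucker n b I \<noteq> 0"
  shows "tdet n (nf n b I) f = tdet n b f / plucker n b I"
proof -
  have "\<forall>s. \<exists>a. s < Suc n \<longrightarrow> nf n b I s = (\<Sum>t<Suc n. a t *s b t)"
    using nf_mem_pspan[of _ n b I] unfolding pspan_def by blast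
  then obtain c where c: "\<And>s. s < Suc n \<Longrightarrow> nf n b I s = (\<Sum>t<Suc n. c s t *s b t)"
    by metis
  have *: "tdet n (nf n b I) f = ndet (Suc n) c * tdet n b f" for f
    by (rule tdet_basis_change[OF c])
  have "tdet n (nf n b I) (enum_set I) = ndet (Suc n) (\<lambda>s r. if s = r then 1 else 0)"
    unfolding tdet_def by (rule ndet_cong) (simp add: nf_enum[OF assms])
  then have "ndet (Suc n) c * plucker n b I = 1"
    by (simp add: * ndet_id plucker_eq_tdet)
  then show ?thesis using assms by (simp add: * field_simps)
qed

lemma plv_nf: "plucker n b I \<noteq> 0 \<Longrightarrow> plv n (nf n b I) = inverse (plucker n b I) *s plv n b"
  by (simp add: vec_eq_iff plv_def tdet_nf plucker_eq_tdet field_simps)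

text \<open>By independence some linear map sends \<open>b\<close> to the coordinate vectors of a
  set \<open>J\<close>, and its exterior power takes \<open>plv n b\<close> to a vector whose
  coordinate \<open>J\<close> is 1. The bound on \<open>Suc n\<close> provides
  \<open>J\<close>.\<close>

lemma nplane_basis_plv_nonzero:
  fixes b :: "nat \<Rightarrow> 'k::{finite,linorder} cvec"
  assumes "nplane_basis n b" "Suc n \<le> CARD('k)"
  shows "plv n b \<noteq> 0"
proof
  assume 0: "plv n b = 0"
  obtain J :: "'k set" where J: "card J = Suc n" using assms(2) by (metis obtain_subset_with_card_n)
  then have J': "J \<in> psets n" by (simp add: psets_def)
  note ind = nplane_basis_inj_independent[OF assms(1)]
  obtain g where g: "Vector_Spaces.linear (*s) (*s) g"
      "\<forall>x\<in>b ` {..<Suc n}. g x = axis (enum_set J (inv_into {..<Suc n} b x)) (1::complex)"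
    using vec.linear_independent_extend[OF ind(2), of "\<lambda>x. axis (enum_set J (inv_into {..<Suc n} b x)) 1"] by blast
  have "plv n (\<lambda>s. matrix g *v b s) = 0"
    by (simp add: cauchy_binet_plv 0)
  moreover have "matrix g *v b s = axis (enum_set J s) 1" if "s < Suc n" for s
    using g that ind(1) by (simp add: matrix_works)
  ultimately have "plv n (\<lambda>s. axis (enum_set J s) (1::complex)) = 0"
    by (metis (no_types, lifting) plv_cong)
  then have "tdet n (\<lambda>s. axis (enum_set J s) 1) (enum_set J) = 0"
    using J' by (auto simp: vec_eq_iff plv_def plucker_eq_tdet split: if_splits)
  moreover have "tdet n (\<lambda>s. axis (enum_set J s) 1) (enum_set J) = ndet (Suc n) (\<lambda>s r. if s = r then 1 else 0)"
    unfolding tdet_def using inj_on_enum_set[OF J']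
    by (intro ndet_cong) (auto simp: axis_def inj_on_def)
  ultimately show False by (simp add: ndet_id)
qed

lemma plv_nonzeroE:
  assumes "plv n b \<noteq> 0"
  obtains I where "I \<in> psets n" "plucker n b I \<noteq> 0"
  using assms by (auto simp: vec_eq_iff plv_def split: if_splits)

section \<open>Continuity of Pluecker coordinates and closedness of the Grassmannian\<close>

lemma tendsto_tdet [tendsto_intros]:
  assumes "\<And>s. s < Suc n \<Longrightarrow> ((\<lambda>x. b x s) \<longlongrightarrow> b' s) F"
  shows "((\<lambda>x. tdet n (b x) f) \<longlongrightarrow> tdet n b' f) F"
  unfolding tdet_def ndet_def
proof (intro tendsto_intros)
  fix p r assume "p \<in> {p. p permutes {..<Suc n}}" "r \<in> {..<Suc n}"
  then have "p r < Suc n" using permutes_in_image[of p "{..<Suc n}" r] by auto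
  then show "((\<lambda>x. b x (p r)) \<longlongrightarrow> b' (p r)) F" by (rule assms)
qed

lemma tendsto_plv:
  assumes "\<And>s. s < Suc n \<Longrightarrow> ((\<lambda>x. b x s) \<longlongrightarrow> b' s) F"
  shows "((\<lambda>x. plv n (b x)) \<longlongrightarrow> plv n b') F"
  by (rule vec_tendstoI) (auto simp: plv_def plucker_eq_tdet intro!: tendsto_tdet assms)

text \<open>Closedness of the Grassmannian, with convergence of the n-planes in both directions:
  limits of points stay in the limit n-plane, and each of its points is approximated. A coordinate
  \<open>I\<close> with \<open>p $ I\<close> nonzero is the pivot: eventually the reduced bases with
  respect to \<open>I\<close> exist, the factors \<open>c j\<close> cancel in their entries, and
  they converge.\<close>

lemma plucker_limit:
  fixes b :: "nat \<Rightarrow> nat \<Rightarrow> 'k::{finite,linorder} cvec"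
  assumes lim: "(\<lambda>j. c j *s plv n (b j)) \<longlonglongrightarrow> p" and "p \<noteq> 0"
  shows "\<exists>b'. nplane_basis n b' \<and> plv n b' = p \<and>
    (\<forall>x y. x \<longlonglongrightarrow> y \<longrightarrow> (\<forall>j. x j \<in> pspan n (b j)) \<longrightarrow> y \<in> pspan n b') \<and>
    (\<forall>y\<in>pspan n b'. \<exists>x. x \<longlonglongrightarrow> y \<and> (\<forall>\<^sub>F j in sequentially. x j \<in> pspan n (b j)))"
proof -
  have limI: "(\<lambda>j. c j * plv n (b j) $ I) \<longlonglongrightarrow> p $ I" for I
    using tendsto_vec_nth[OF lim, of I] by simp
  obtain I where pI: "p $ I \<noteq> 0" using \<open>p \<noteq> 0\<close> by (auto simp: vec_eq_iff)
  have ev: "\<forall>\<^sub>F j in sequentially. c j * plv n (b j) $ I \<noteq> 0"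
    using tendsto_imp_eventually_ne[OF limI pI] .
  have I: "I \<in> psets n"
  proof (rule ccontr)
    assume "I \<notin> psets n"
    then have "(\<lambda>j. 0) \<longlonglongrightarrow> p $ I" using limI[of I] by (simp add: plv_def)
    then show False using pI by (simp add: LIMSEQ_const_iff)
  qed
  have evI: "\<forall>\<^sub>F j in sequentially. plucker n (b j) I \<noteq> 0 \<and> c j \<noteq> 0"
    using ev by eventually_elim (auto simp: plv_def I)
  have tl: "convergent (\<lambda>j. c j * tdet n (b j) f)" for f
  proof (cases "inj_on f {..<Suc n}")
    case True
    let ?J = "f ` {..<Suc n}"
    obtain q where q: "q permutes {..<Suc n}" "\<And>r. r < Suc n \<Longrightarrow> f r = enum_set ?J (q r)"
      using inj_on_eq_enum_permutes[OF True] by blast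
    have J: "?J \<in> psets n" using True by (simp add: psets_def card_image)
    have "c j * tdet n (b j) f = of_int (sign q) * (c j * plv n (b j) $ ?J)" for j
      by (simp only: tdet_permute[where f = "enum_set ?J" and g = f, OF q]) (simp add: plv_def J plucker_eq_tdet)
    then have "(\<lambda>j. c j * tdet n (b j) f) \<longlonglongrightarrow> of_int (sign q) * p $ ?J"
      by (simp only: tendsto_mult_left limI)
    then show ?thesis by (auto simp: convergent_def)
  qed (simp add: tdet_not_inj convergent_const)
  \<comment> \<open>The limits of the reduced basis vectors. Numerator and denominator both carry
    the factor \<open>c j\<close>, since only the products converge.\<close>
  define \<beta> where "\<beta> s = (\<chi> k. lim (\<lambda>j. c j * tdet n (b j) ((enum_set I)(s := k))) / p $ I)" for s
  have nf_lim: "(\<lambda>j. nf n (b j) I s) \<longlonglongrightarrow> \<beta> s" for s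
  proof (rule vec_tendstoI)
    fix k
    let ?f = "(enum_set I)(s := k)"
    have "(\<lambda>j. c j * tdet n (b j) ?f / (c j * plv n (b j) $ I)) \<longlonglongrightarrow> \<beta> s $ k"
      unfolding \<beta>_def vec_lambda_beta
      by (rule tendsto_divide[OF tl[of ?f, unfolded convergent_LIMSEQ_iff] limI pI])
    moreover have "\<forall>\<^sub>F j in sequentially. c j * tdet n (b j) ?f / (c j * plv n (b j) $ I) = nf n (b j) I s $ k"
      using evI by eventually_elim (simp add: nf_def plv_def I)
    ultimately show "(\<lambda>j. nf n (b j) I s $ k) \<longlonglongrightarrow> \<beta> s $ k"
      by (rule Lim_transform_eventually)
  qed
  have "(\<lambda>j. plv n (nf n (b j) I)) \<longlonglongrightarrow> plv n \<beta>"
    by (rule tendsto_plv) (rule nf_lim)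
  moreover have "(\<lambda>j. plv n (nf n (b j) I)) \<longlonglongrightarrow> inverse (p $ I) *s p"
  proof -
    have "(\<lambda>j. inverse (c j * plv n (b j) $ I) *s (c j *s plv n (b j))) \<longlonglongrightarrow> inverse (p $ I) *s p"
      by (rule vec_tendstoI) (unfold vector_smult_component, intro tendsto_mult tendsto_inverse limI pI)
    moreover have "\<forall>\<^sub>F j in sequentially. inverse (c j * plv n (b j) $ I) *s (c j *s plv n (b j)) = plv n (nf n (b j) I)"
      using evI by eventually_elim (simp add: plv_nf plv_def[of n "b _"] I vec_eq_iff)
    ultimately show ?thesis by (rule Lim_transform_eventually)
  qed
  ultimately have plv\<beta>: "plv n \<beta> = inverse (p $ I) *s p" by (rule LIMSEQ_unique)
  have "plv n \<beta> $ I = 1" using pI by (simp add: plv\<beta>)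
  then have pl\<beta>: "plucker n \<beta> I = 1" by (simp add: plv_def I)
  \<comment> \<open>Rescaling one vector turns the Pluecker vector from a multiple of
    \<open>p\<close> into \<open>p\<close> itself.\<close>
  define b' where "b' = \<beta>(0 := p $ I *s \<beta> 0)"
  have plvb': "plv n b' = p"
    using plv_lincomb2[of 0 n \<beta> "p $ I" "\<beta> 0" 0 0] pI by (simp add: b'_def plv\<beta>)
  then have plb': "plucker n b' I = p $ I" by (simp add: plv_def I flip: plvb')
  then have plb'0: "plucker n b' I \<noteq> 0" using pI by simp
  have nf\<beta>: "nf n b' I = nf n \<beta> I"
  proof -
    have "plv n b' = p $ I *s plv n \<beta>" using pI by (simp add: plv\<beta> plvb')
    from tdet_scale[OF this] show ?thesis using pI pl\<beta> by (simp add: fun_eq_iff nf_def plb' vec_eq_iff)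
  qed
  have \<beta>_nf: "nf n b' I s = \<beta> s" if "s < Suc n" for s
  proof -
    \<comment> \<open>The identity block survives the limit, so \<beta> is its own reduced
      basis.\<close>
    have id: "\<beta> t $ enum_set I r = (if t = r then 1 else 0)" if "t < Suc n" "r < Suc n" for t r
    proof (rule LIMSEQ_unique[OF tendsto_vec_nth[OF nf_lim]])
      have "\<forall>\<^sub>F j in sequentially. (if t = r then 1 else 0) = nf n (b j) I t $ enum_set I r"
        using evI by eventually_elim (simp add: nf_enum that)
      then show "(\<lambda>j. nf n (b j) I t $ enum_set I r) \<longlonglongrightarrow> (if t = r then 1 else 0)"
        by (rule Lim_transform_eventually[OF tendsto_const])
    qed
    have "plucker n \<beta> I \<noteq> 0" using pl\<beta> by simp
    from mem_pspan_iff_nf[OF this, of "\<beta> s"] pspan_base[OF that, of \<beta>]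
    have "\<beta> s = (\<Sum>t<Suc n. \<beta> s $ enum_set I t *s nf n \<beta> I t)" by simp
    also have "\<dots> = (\<Sum>t<Suc n. if t = s then nf n \<beta> I s else 0)"
      using that by (intro sum.cong) (auto simp: id)
    also have "\<dots> = nf n \<beta> I s" using that by (simp del: sum.lessThan_Suc)
    finally show ?thesis by (simp add: nf\<beta>)
  qed
  have lim_sum: "(\<lambda>j. \<Sum>s<Suc n. x j $ enum_set I s *s nf n (b j) I s)
      \<longlonglongrightarrow> (\<Sum>s<Suc n. y $ enum_set I s *s nf n b' I s)" if "x \<longlonglongrightarrow> y" for x y
  proof (rule tendsto_sum, rule vec_tendstoI)
    fix s k assume "s \<in> {..<Suc n}"
    then have "(\<lambda>j. nf n (b j) I s $ k) \<longlonglongrightarrow> nf n b' I s $ k"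
      using tendsto_vec_nth[OF nf_lim[of s]] by (simp add: \<beta>_nf)
    then show "(\<lambda>j. (x j $ enum_set I s *s nf n (b j) I s) $ k)
        \<longlonglongrightarrow> (y $ enum_set I s *s nf n b' I s) $ k"
      unfolding vector_smult_component by (intro tendsto_mult tendsto_vec_nth[OF that])
  qed
  show ?thesis
  proof (rule exI[of _ b'], intro conjI allI impI ballI)
    show "nplane_basis n b'" by (rule nplane_basis_if_plucker_nonzero[OF plb'0])
    show "plv n b' = p" by (rule plvb')
  next
    fix x y assume xy: "x \<longlonglongrightarrow> y" and mem: "\<forall>j. x j \<in> pspan n (b j)"
    have "\<forall>\<^sub>F j in sequentially. x j = (\<Sum>s<Suc n. x j $ enum_set I s *s nf n (b j) I s)"
      using evI by eventually_elim (use mem mem_pspan_iff_nf in blast)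
    from Lim_transform_eventually[OF xy this]
    have "y = (\<Sum>s<Suc n. y $ enum_set I s *s nf n b' I s)"
      using lim_sum[OF xy] by (rule LIMSEQ_unique)
    then show "y \<in> pspan n b'" by (simp only: mem_pspan_iff_nf[OF plb'0])
  next
    fix y assume y: "y \<in> pspan n b'"
    \<comment> \<open>The approximating points keep the pivot coordinates of \<open>y\<close>; only
      the reduced basis moves.\<close>
    define x where "x j = (\<Sum>s<Suc n. y $ enum_set I s *s nf n (b j) I s)" for j
    have "y = (\<Sum>s<Suc n. y $ enum_set I s *s nf n b' I s)"
      using y by (simp only: mem_pspan_iff_nf[OF plb'0])
    then have "x \<longlonglongrightarrow> y"
      unfolding x_def using lim_sum[OF tendsto_const[of y]] by argo
    moreover have "\<forall>\<^sub>F j in sequentially. x j \<in> pspan n (b j)"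
      using evI
    proof eventually_elim
      case (elim j)
      have "x j \<in> pspan n (nf n (b j) I)" unfolding pspan_def x_def by (intro CollectI exI) (rule refl)
      then show ?case using pspan_nf elim by blast
    qed
    ultimately show "\<exists>x. x \<longlonglongrightarrow> y \<and> (\<forall>\<^sub>F j in sequentially. x j \<in> pspan n (b j))" by blast
  qed
qed

section \<open>Limits of exterior powers of group elements\<close>

definition cscale :: "complex \<Rightarrow> 'k::finite cmat \<Rightarrow> 'k cmat" where
  "cscale c A = (\<chi> i j. c * A $ i $ j)"

lemma cscale_nth [simp]: "cscale c A $ i $ j = c * A $ i $ j"
  by (simp add: cscale_def)

lemma pcls_def': "pcls A = {cscale c A | c. c \<noteq> 0}"
  by (simp add: pcls_def cscale_def)

lemma cscale_cscale [simp]: "cscale c (cscale d A) = cscale (c * d) A"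
  by (simp add: vec_eq_iff mult_ac)

lemma cscale_one [simp]: "cscale 1 A = A"
  by (simp add: vec_eq_iff)

lemma cscale_of_real: "cscale (of_real r) A = r *\<^sub>R A"
  by (auto simp: vec_eq_iff scaleR_conv_of_real[where 'a = complex])

lemma cscale_mult_vec: "cscale c A *v x = c *s (A *v x)"
  by (simp add: vec_eq_iff matrix_vector_mult_def sum_distrib_left mult_ac)

lemma cscale_mult_left: "cscale c A ** B = cscale c (A ** B)"
  by (simp add: vec_eq_iff matrix_matrix_mult_def sum_distrib_left mult_ac)

lemma cscale_mult_right: "A ** cscale c B = cscale c (A ** B)"
  by (simp add: vec_eq_iff matrix_matrix_mult_def sum_distrib_left mult_ac)

lemma tendsto_cscale:
  assumes "(M \<longlongrightarrow> S) F"
  shows "((\<lambda>x. cscale c (M x)) \<longlongrightarrow> cscale c S) F"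
  by (intro vec_tendstoI) (unfold cscale_nth, intro tendsto_mult tendsto_const tendsto_vec_nth assms)

lemma tendsto_mult_vec:
  fixes M :: "'a \<Rightarrow> (complex, 'k::finite) vec ^ 'm::finite"
  assumes "(M \<longlongrightarrow> S) F" "(w \<longlongrightarrow> y) F"
  shows "((\<lambda>x. M x *v w x) \<longlongrightarrow> S *v y) F"
  by (intro vec_tendstoI, unfold matrix_vector_mult_def vec_lambda_beta) (intro tendsto_sum tendsto_mult tendsto_vec_nth assms)

lemma tendsto_matrix_mult:
  fixes M :: "'a \<Rightarrow> 'k::finite cmat"
  assumes "(M \<longlongrightarrow> S) F"
  shows "((\<lambda>x. G ** M x) \<longlongrightarrow> G ** S) F" "((\<lambda>x. M x ** G) \<longlongrightarrow> S ** G) F"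
  by (intro vec_tendstoI; unfold matrix_matrix_mult_def vec_lambda_beta;
      intro tendsto_sum tendsto_mult tendsto_vec_nth tendsto_const assms)+

section \<open>Classes in PGL and their representatives\<close>

lemma invertible_cscale:
  assumes "invertible A" "c \<noteq> 0"
  shows "invertible (cscale c A)"
proof -
  obtain B where "A ** B = mat 1" "B ** A = mat 1" using assms(1) by (auto simp: invertible_def)
  then show ?thesis
    unfolding invertible_def using assms(2)
    by (intro exI[of _ "cscale (inverse c) B"]) (simp add: cscale_mult_left cscale_mult_right)
qed

lemma PGL_invertible: "g \<in> PGL \<Longrightarrow> A \<in> g \<Longrightarrow> invertible A"
  by (auto simp: PGL_def pcls_def' invertible_cscale)

lemma mem_pcls: "A \<in> pcls A"
  unfolding pcls_def' by (auto intro!: exI[of _ 1])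

lemma PGL_nonempty: "g \<in> PGL \<Longrightarrow> \<exists>A. A \<in> g"
  using mem_pcls by (auto simp: PGL_def)

lemma PGL_cscale: "g \<in> PGL \<Longrightarrow> A \<in> g \<Longrightarrow> c \<noteq> 0 \<Longrightarrow> cscale c A \<in> g"
  by (auto simp: PGL_def pcls_def')

lemma PGL_eq_pcls: "g \<in> PGL \<Longrightarrow> A \<in> g \<Longrightarrow> g = pcls A"
proof -
  assume "g \<in> PGL" and A: "A \<in> g"
  then obtain B where g: "g = pcls B" by (auto simp: PGL_def)
  then obtain c where c: "c \<noteq> 0" "A = cscale c B" using A by (auto simp: pcls_def')
  show "g = pcls A"
  proof (intro equalityI subsetI)
    fix X assume "X \<in> g"
    then obtain d where "d \<noteq> 0" "X = cscale d B" using g by (auto simp: pcls_def')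
    then show "X \<in> pcls A" using c by (auto simp: pcls_def' intro!: exI[of _ "d / c"])
  next
    fix X assume "X \<in> pcls A"
    then show "X \<in> g" using c unfolding g by (auto simp: pcls_def')
  qed
qed

lemma matrix_inv_works:
  fixes A :: "'k::finite cmat"
  assumes "invertible A"
  shows "A ** matrix_inv A = mat 1" "matrix_inv A ** A = mat 1"
  using someI_ex[OF assms[unfolded invertible_def]] by (auto simp: matrix_inv_def)

lemma plv_mult_invertible_nonzero:
  fixes A :: "'k::{finite,linorder} cmat"
  assumes "invertible A" "plv n b \<noteq> 0"
  shows "plv n (\<lambda>s. A *v b s) \<noteq> 0"
proof
  assume "plv n (\<lambda>s. A *v b s) = 0"
  then have "plv n (\<lambda>s. matrix_inv A *v (A *v b s)) = 0"
    by (simp only: cauchy_binet_plv[of n "matrix_inv A"] matrix_vector_mult_0_right)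
  then show False using assms by (simp add: matrix_vector_mul_assoc matrix_inv_works)
qed

lemma nplane_basis_if_plv_nonzero: "plv n b \<noteq> 0 \<Longrightarrow> nplane_basis n b"
  using nplane_basis_if_plucker_nonzero plv_nonzeroE by metis

lemma matrix_vector_sum_scale:
  "A *v (\<Sum>t<Suc n. a t *s b t) = (\<Sum>t<Suc n. a t *s (A *v b t))"
  for A :: "'k::finite cmat"
  by (simp only: vec.sum vec.scale)

lemma pspan_mult: "pspan n (\<lambda>s. A *v b s) = (*v) A ` pspan n b"
  for A :: "'k::finite cmat"
  unfolding pspan_def by (auto simp: matrix_vector_sum_scale[symmetric] image_iff simp del: sum.lessThan_Suc)

text \<open>Infinitely many group elements arbitrarily close to S replace a sequence of distinct ones; this makes
  the set of limits visibly closed. No normalization is imposed, hence S = 0 is not excluded.\<close>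
definition hat_limit :: "nat \<Rightarrow> ('k::{finite,linorder} cmat) set set \<Rightarrow> 'k set cmat \<Rightarrow> bool" where
  "hat_limit n \<Gamma> S \<longleftrightarrow>
    (\<forall>e>0. infinite {g \<in> \<Gamma>. \<exists>A\<in>g. \<exists>c. c \<noteq> 0 \<and> dist (cscale c (hat n A)) S < e})"

lemma hat_limitI:
  assumes "inj \<sigma>" "\<And>\<nu>. \<sigma> \<nu> \<in> \<Gamma>" "\<And>\<nu>. A \<nu> \<in> \<sigma> \<nu>" "\<And>\<nu>. c \<nu> \<noteq> 0"
    and lim: "(\<lambda>\<nu>. cscale (c \<nu>) (hat n (A \<nu>))) \<longlonglongrightarrow> S"
  shows "hat_limit n \<Gamma> S"
  unfolding hat_limit_def
proof (intro allI impI)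
  fix e :: real assume "e > 0"
  then obtain m where m: "\<And>\<nu>. \<nu> \<ge> m \<Longrightarrow> dist (cscale (c \<nu>) (hat n (A \<nu>))) S < e"
    using lim by (auto simp: lim_sequentially)
  have "infinite (\<sigma> ` {m..})"
    using assms(1) by (metis finite_imageD infinite_Ici inj_on_subset subset_UNIV)
  moreover have "\<sigma> ` {m..} \<subseteq> {g \<in> \<Gamma>. \<exists>A\<in>g. \<exists>c. c \<noteq> 0 \<and> dist (cscale c (hat n A)) S < e}"
    using assms(2-4) m by fastforce
  ultimately show "infinite {g \<in> \<Gamma>. \<exists>A\<in>g. \<exists>c. c \<noteq> 0 \<and> dist (cscale c (hat n A)) S < e}"
    using finite_subset by blast
qed

text \<open>Each new element avoids the finitely many earlier ones. In this way infinitely many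
  close elements turn back into a sequence of distinct ones.\<close>

lemma inj_choice:
  fixes X :: "nat \<Rightarrow> 'a set"
  assumes "\<And>j. infinite (X j)"
  shows "\<exists>\<sigma>. inj \<sigma> \<and> (\<forall>j. \<sigma> j \<in> X j)"
proof -
  have "\<exists>f. \<forall>j. f j \<in> X j \<and> f j \<notin> f ` {..<j}"
  proof (rule dependent_wf_choice[of "{(x, y). x < y}"])
    show "wf {(x, y::nat). x < y}" by (rule wf_less)
    show "\<exists>r. r \<in> X j \<and> r \<notin> f ` {..<j}" for f :: "nat \<Rightarrow> 'a" and j
      using assms[of j] by (meson finite_imageI finite_lessThan finite_subset subsetI)
  qed (auto simp: image_iff)
  then obtain f where f: "\<And>j. f j \<in> X j" "\<And>j. f j \<notin> f ` {..<j}" by blast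
  have "inj f"
  proof (rule injI)
    fix i j assume "f i = f j"
    then show "i = j" using f(2)[of i] f(2)[of j] by (metis image_eqI lessThan_iff linorder_neqE_nat)
  qed
  with f(1) show ?thesis by auto
qed

lemma hat_limit_sequence:
  assumes "hat_limit n \<Gamma> S"
  shows "\<exists>\<sigma> A c. inj \<sigma> \<and> (\<forall>\<nu>. \<sigma> \<nu> \<in> \<Gamma>) \<and> (\<forall>\<nu>. A \<nu> \<in> \<sigma> \<nu>) \<and> (\<forall>\<nu>. c \<nu> \<noteq> 0) \<and>
    (\<lambda>\<nu>. cscale (c \<nu>) (hat n (A \<nu>))) \<longlonglongrightarrow> S"
proof -
  define X where "X j = {g \<in> \<Gamma>. \<exists>A\<in>g. \<exists>c. c \<noteq> 0 \<and>
    dist (cscale c (hat n A)) S < inverse (real (Suc j))}" for j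
  have "infinite (X j)" for j using assms by (simp add: hat_limit_def X_def)
  then obtain \<sigma> where \<sigma>: "inj \<sigma>" "\<And>j. \<sigma> j \<in> X j" using inj_choice[of X] by blast
  have "\<exists>z. fst z \<in> \<sigma> j \<and> snd z \<noteq> 0 \<and> dist (cscale (snd z) (hat n (fst z))) S < inverse (real (Suc j))" for j
  proof -
    obtain A c where "A \<in> \<sigma> j" "c \<noteq> 0" "dist (cscale c (hat n A)) S < inverse (real (Suc j))"
      using \<sigma>(2)[of j] unfolding X_def by blast
    then show ?thesis by (intro exI[of _ "(A, c)"]) simp
  qed
  then obtain z where z: "\<And>j. fst (z j) \<in> \<sigma> j \<and> snd (z j) \<noteq> 0 \<and>
      dist (cscale (snd (z j)) (hat n (fst (z j)))) S < inverse (real (Suc j))"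
    by metis
  have "(\<lambda>j. dist (cscale (snd (z j)) (hat n (fst (z j)))) S) \<longlonglongrightarrow> 0"
    by (rule tendsto_sandwich[OF _ _ tendsto_const LIMSEQ_inverse_real_of_nat])
       (intro always_eventually allI, use z in \<open>auto intro: less_imp_le simp del: of_nat_Suc\<close>)+
  then have "(\<lambda>j. cscale (snd (z j)) (hat n (fst (z j)))) \<longlonglongrightarrow> S"
    by (subst tendsto_dist_iff)
  moreover have "\<forall>j. \<sigma> j \<in> \<Gamma>" using \<sigma>(2) by (simp add: X_def)
  ultimately show ?thesis
    using \<sigma>(1) z by (intro exI[of _ \<sigma>] exI[of _ "\<lambda>j. fst (z j)"] exI[of _ "\<lambda>j. snd (z j)"]) blast
qed

text \<open>Elements close to some \<open>S j\<close> that is close to \<open>S'\<close> are close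
  to \<open>S'\<close>. Since limits are stated through infinite sets, the diagonal choice reduces
  to the triangle inequality.\<close>

lemma hat_limit_closed:
  assumes "\<And>j. hat_limit n \<Gamma> (S j)" "S \<longlonglongrightarrow> S'"
  shows "hat_limit n \<Gamma> S'"
  unfolding hat_limit_def
proof (intro allI impI)
  fix e :: real assume "e > 0"
  then obtain j where j: "dist (S j) S' < e / 2"
    using assms(2) unfolding lim_sequentially by (meson half_gt_zero le_refl)
  have "{g \<in> \<Gamma>. \<exists>A\<in>g. \<exists>c. c \<noteq> 0 \<and> dist (cscale c (hat n A)) (S j) < e / 2}
    \<subseteq> {g \<in> \<Gamma>. \<exists>A\<in>g. \<exists>c. c \<noteq> 0 \<and> dist (cscale c (hat n A)) S' < e}"
  proof (intro subsetI CollectI conjI)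
    fix g assume "g \<in> {g \<in> \<Gamma>. \<exists>A\<in>g. \<exists>c. c \<noteq> 0 \<and> dist (cscale c (hat n A)) (S j) < e / 2}"
    then obtain A c where g: "g \<in> \<Gamma>" "A \<in> g" "c \<noteq> 0" "dist (cscale c (hat n A)) (S j) < e / 2" by blast
    then have "dist (cscale c (hat n A)) S' < e"
      using j dist_triangle[of "cscale c (hat n A)" S' "S j"] by simp
    with g show "g \<in> \<Gamma>" "\<exists>A\<in>g. \<exists>c. c \<noteq> 0 \<and> dist (cscale c (hat n A)) S' < e" by blast+
  qed
  moreover have "infinite {g \<in> \<Gamma>. \<exists>A\<in>g. \<exists>c. c \<noteq> 0 \<and> dist (cscale c (hat n A)) (S j) < e / 2}"
    using assms(1)[of j, unfolded hat_limit_def, rule_format, of "e / 2"] \<open>e > 0\<close> by simp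
  ultimately show "infinite {g \<in> \<Gamma>. \<exists>A\<in>g. \<exists>c. c \<noteq> 0 \<and> dist (cscale c (hat n A)) S' < e}"
    using finite_subset by blast
qed

lemma hat_limit_cscale:
  assumes "hat_limit n \<Gamma> S" "d \<noteq> 0"
  shows "hat_limit n \<Gamma> (cscale d S)"
proof -
  obtain \<sigma> A c where s: "inj \<sigma>" "\<And>\<nu>. \<sigma> \<nu> \<in> \<Gamma>" "\<And>\<nu>. A \<nu> \<in> \<sigma> \<nu>" "\<And>\<nu>. c \<nu> \<noteq> 0"
    "(\<lambda>\<nu>. cscale (c \<nu>) (hat n (A \<nu>))) \<longlonglongrightarrow> S"
    using hat_limit_sequence[OF assms(1)] by blast
  show ?thesis
    using s(4) \<open>d \<noteq> 0\<close> tendsto_cscale[OF s(5), of d]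
    by (intro hat_limitI[OF s(1-3), of "\<lambda>\<nu>. d * c \<nu>"]) auto
qed

text \<open>Left translation by \<open>g\<close> is injective on \<Gamma>, so the translated
  elements stay distinct; the limit follows since \<open>hat\<close> is multiplicative.\<close>

lemma hat_limit_mult:
  assumes \<Gamma>: "\<Gamma> \<subseteq> PGL" "\<And>h. h \<in> \<Gamma> \<Longrightarrow> pmul g h \<in> \<Gamma>" and g: "g \<in> \<Gamma>" "G \<in> g"
    and "hat_limit n \<Gamma> S"
  shows "hat_limit n \<Gamma> (hat n G ** S)"
proof -
  obtain \<sigma> A c where s: "inj \<sigma>" "\<And>\<nu>. \<sigma> \<nu> \<in> \<Gamma>" "\<And>\<nu>. A \<nu> \<in> \<sigma> \<nu>" "\<And>\<nu>. c \<nu> \<noteq> 0"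
    "(\<lambda>\<nu>. cscale (c \<nu>) (hat n (A \<nu>))) \<longlonglongrightarrow> S"
    using hat_limit_sequence[OF assms(5)] by blast
  have inv: "invertible G" using \<Gamma>(1) g PGL_invertible by blast
  have gG: "g = pcls G" using \<Gamma>(1) g PGL_eq_pcls by blast
  have "h = h'" if h: "h \<in> \<Gamma>" "h' \<in> \<Gamma>" and eq: "pmul g h = pmul g h'" for h h'
  proof -
    obtain B where B: "B \<in> h" using h \<Gamma> PGL_nonempty by blast
    then have "G ** B \<in> pmul g h" using g(2) unfolding pmul_def by blast
    then have "G ** B \<in> pmul g h'" by (simp only: eq)
    then obtain G' B' where G': "G' \<in> g" "B' \<in> h'" "G ** B = G' ** B'"
      unfolding pmul_def by blast
    from G'(1) obtain d where "d \<noteq> 0" "G' = cscale d G" unfolding gG pcls_def' by blast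
    with G' have B': "d \<noteq> 0" "B' \<in> h'" "G ** B = cscale d G ** B'" by simp_all
    then have "matrix_inv G ** (G ** B) = matrix_inv G ** (G ** cscale d B')"
      by (simp add: cscale_mult_left cscale_mult_right)
    then have "B = cscale d B'" by (simp only: matrix_mul_assoc matrix_inv_works[OF inv] matrix_mul_lid)
    moreover have "h \<in> PGL" "h' \<in> PGL" using h \<Gamma>(1) by blast+
    ultimately have "B \<in> h'" using B' PGL_cscale[of h' B' d] by simp
    then show "h = h'" using B PGL_eq_pcls[of h B] PGL_eq_pcls[of h' B] \<open>h \<in> PGL\<close> \<open>h' \<in> PGL\<close> by simp
  qed
  then have "inj (\<lambda>\<nu>. pmul g (\<sigma> \<nu>))"
    using s(1,2) by (auto simp: inj_def)
  moreover have "G ** A \<nu> \<in> pmul g (\<sigma> \<nu>)" for \<nu>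
    using g s(3)[of \<nu>] unfolding pmul_def by blast
  moreover have "(\<lambda>\<nu>. cscale (c \<nu>) (hat n (G ** A \<nu>))) \<longlonglongrightarrow> hat n G ** S"
    using tendsto_matrix_mult(1)[OF s(5), of "hat n G"] by (simp add: hat_mult cscale_mult_right)
  ultimately show ?thesis
    using s(2,4) \<Gamma>(2)
    by (intro hat_limitI[where \<sigma> = "\<lambda>\<nu>. pmul g (\<sigma> \<nu>)" and A = "\<lambda>\<nu>. G ** A \<nu>" and c = c]) auto
qed

text \<open>\<open>hat n (mat 1)\<close> projects onto the coordinates in \<open>psets n\<close>,
  and \<open>S\<close> absorbs it, being a limit of matrices that do. Hence \<open>S\<close> is
  determined by its values on the decomposable basis vectors, and what holds for decomposable
  vectors extends to the whole image of \<open>S\<close>.\<close>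

lemma hat_limit_mult_vec:
  assumes "hat_limit n \<Gamma> S"
  shows "S *v x = (\<Sum>J\<in>psets n. x $ J *s (S *v plv n (\<lambda>s. column (enum_set J s) (mat 1))))"
proof -
  obtain \<sigma> A c where s: "inj \<sigma>" "\<And>\<nu>. \<sigma> \<nu> \<in> \<Gamma>" "\<And>\<nu>. A \<nu> \<in> \<sigma> \<nu>" "\<And>\<nu>. c \<nu> \<noteq> 0"
    "(\<lambda>\<nu>. cscale (c \<nu>) (hat n (A \<nu>))) \<longlonglongrightarrow> S"
    using hat_limit_sequence[OF assms] by blast
  have "cscale (c \<nu>) (hat n (A \<nu>)) ** hat n (mat 1) = cscale (c \<nu>) (hat n (A \<nu>))" for \<nu>
    by (simp add: cscale_mult_left matrix_mul_rid flip: hat_mult)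
  with tendsto_matrix_mult(2)[OF s(5), of "hat n (mat 1)"]
  have "(\<lambda>\<nu>. cscale (c \<nu>) (hat n (A \<nu>))) \<longlonglongrightarrow> S ** hat n (mat 1)" by simp
  then have S: "S ** hat n (mat 1) = S" using s(5) by (rule LIMSEQ_unique)
  have "hat n (mat 1) *v x = (\<Sum>J\<in>psets n. x $ J *s plv n (\<lambda>s. column (enum_set J s) (mat 1)))"
  proof -
    have "(\<Sum>J\<in>UNIV. hat n (mat 1) $ I $ J * x $ J) = (\<Sum>J\<in>psets n. hat n (mat 1) $ I $ J * x $ J)" for I
      by (intro sum.mono_neutral_right) (auto simp: hat_def)
    then show ?thesis
      by (auto simp: vec_eq_iff matrix_vector_mult_def hat_def plv_def minor_eq_plucker mult_ac intro!: sum.cong)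
  qed
  moreover have "S *v x = S *v (hat n (mat 1) *v x)"
    by (simp only: matrix_vector_mul_assoc S)
  ultimately have "S *v x = S *v (\<Sum>J\<in>psets n. x $ J *s plv n (\<lambda>s. column (enum_set J s) (mat 1)))"
    by (simp only:)
  also have "\<dots> = (\<Sum>J\<in>psets n. x $ J *s (S *v plv n (\<lambda>s. column (enum_set J s) (mat 1))))"
    by (simp only: vec.sum vec.scale)
  finally show ?thesis .
qed

lemma hat_limit_support:
  assumes "hat_limit n \<Gamma> S" "I \<notin> psets n \<or> J \<notin> psets n"
  shows "S $ I $ J = 0"
proof -
  obtain \<sigma> A c where "inj \<sigma>" "\<And>\<nu>. \<sigma> \<nu> \<in> \<Gamma>" "\<And>\<nu>. A \<nu> \<in> \<sigma> \<nu>" "\<And>\<nu>. c \<nu> \<noteq> 0"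
    and lim: "(\<lambda>\<nu>. cscale (c \<nu>) (hat n (A \<nu>))) \<longlonglongrightarrow> S"
    using hat_limit_sequence[OF assms(1)] by blast
  have "(\<lambda>\<nu>. cscale (c \<nu>) (hat n (A \<nu>)) $ I $ J) \<longlonglongrightarrow> S $ I $ J"
    by (intro tendsto_vec_nth lim)
  moreover have "cscale (c \<nu>) (hat n (A \<nu>)) $ I $ J = 0" for \<nu>
    using assms(2) by (auto simp: hat_def)
  ultimately show ?thesis by (simp only: LIMSEQ_const_iff)
qed

section \<open>Normalized representatives\<close>

lemma mat_maxabs_ge: "cmod (A $ i $ j) \<le> mat_maxabs A"
proof -
  have "{cmod (A $ i $ j) | i j. True} = (\<lambda>(i, j). cmod (A $ i $ j)) ` UNIV" by auto
  then show ?thesis unfolding mat_maxabs_def by (intro Max_ge) auto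
qed

lemma mat_maxabs_cscale: "mat_maxabs (cscale c A) = cmod c * mat_maxabs A"
proof -
  have *: "{cmod (A $ i $ j) | i j. True} = (\<lambda>(i, j). cmod (A $ i $ j)) ` UNIV" for A :: "'b::finite cmat"
    by auto
  have "mat_maxabs A \<in> (\<lambda>(i, j). cmod (A $ i $ j)) ` UNIV"
    unfolding mat_maxabs_def * by (intro Max_in) auto
  then obtain i j where ij: "mat_maxabs A = cmod (A $ i $ j)" by auto
  show ?thesis
    unfolding mat_maxabs_def[of "cscale c A"] *
    using ij mat_maxabs_ge[of A] by (intro Max_eqI) (auto simp: norm_mult image_iff intro!: mult_left_mono)
qed

lemma bounded_cmat:
  fixes R :: "nat \<Rightarrow> 'k::finite cmat"
  assumes "\<And>\<nu> i j. cmod (R \<nu> $ i $ j) \<le> 1"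
  shows "bounded (range R)"
proof -
  have "norm (R \<nu>) \<le> (\<Sum>i\<in>(UNIV::'k set). \<Sum>j\<in>(UNIV::'k set). 1)" for \<nu>
  proof -
    have "norm (R \<nu>) \<le> (\<Sum>i\<in>UNIV. norm (R \<nu> $ i))"
      unfolding norm_vec_def[of "R \<nu>"] by (rule L2_set_le_sum) auto
    also have "\<dots> \<le> (\<Sum>i\<in>(UNIV::'k set). \<Sum>j\<in>(UNIV::'k set). 1)"
    proof (rule sum_mono)
      fix i
      have "norm (R \<nu> $ i) \<le> (\<Sum>j\<in>UNIV. norm (R \<nu> $ i $ j))"
        unfolding norm_vec_def[of "R \<nu> $ i"] by (rule L2_set_le_sum) auto
      also have "\<dots> \<le> (\<Sum>j\<in>(UNIV::'k set). 1)" by (rule sum_mono) (rule assms)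
      finally show "norm (R \<nu> $ i) \<le> (\<Sum>j\<in>(UNIV::'k set). 1)" .
    qed
    finally show ?thesis .
  qed
  then show ?thesis unfolding bounded_iff by auto
qed

text \<open>A normal sequence also needs convergent representatives of the elements themselves; once
  normalized, these are bounded, so a subsequence supplies them.\<close>

lemma PGL_subseq_normalized_limit:
  fixes \<sigma> :: "nat \<Rightarrow> ('k::finite cmat) set"
  assumes "\<And>\<nu>. \<sigma> \<nu> \<in> PGL"
  obtains r T where "strict_mono r" "normalized_limit (\<sigma> \<circ> r) T"
proof -
  have "\<exists>R. R \<in> \<sigma> \<nu> \<and> mat_maxabs R = 1" for \<nu>
  proof -
    obtain A where A: "A \<in> \<sigma> \<nu>" using assms PGL_nonempty by blast
    then have "invertible A" using assms PGL_invertible by blast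
    then obtain B where "A ** B = mat 1" by (auto simp: invertible_def)
    \<comment> \<open>\<open>undefined\<close> serves as an arbitrary index: any diagonal entry
      rules out \<open>A = 0\<close>.\<close>
    then have "(A ** B) $ undefined $ undefined = 1" by (simp add: mat_def)
    then have "A \<noteq> 0" by (auto simp: matrix_matrix_mult_def)
    then obtain i j where "A $ i $ j \<noteq> 0" by (auto simp: vec_eq_iff)
    then have pos: "mat_maxabs A > 0" using mat_maxabs_ge[of A i j] by (metis less_le_trans zero_less_norm_iff)
    show ?thesis
      using pos PGL_cscale[OF assms A, of "of_real (inverse (mat_maxabs A))"]
      by (intro exI[of _ "cscale (of_real (inverse (mat_maxabs A))) A"]) (simp add: mat_maxabs_cscale norm_inverse)
  qed
  then obtain R where R: "\<And>\<nu>. R \<nu> \<in> \<sigma> \<nu>" "\<And>\<nu>. mat_maxabs (R \<nu>) = 1" by metis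
  have "bounded (range R)" using R(2) mat_maxabs_ge[of "R _"] by (intro bounded_cmat) simp
  then obtain T r where r: "strict_mono r" "(R \<circ> r) \<longlonglongrightarrow> T"
    using bounded_imp_convergent_subsequence by blast
  have "normalized_limit (\<sigma> \<circ> r) T"
    unfolding normalized_limit_def by (intro exI[of _ "R \<circ> r"]) (auto simp: R r)
  then show thesis using r that by blast
qed

lemma tendsto_MAX:
  fixes f :: "'i \<Rightarrow> 'a \<Rightarrow> real"
  assumes "finite X" "X \<noteq> {}" "\<And>i. i \<in> X \<Longrightarrow> (f i \<longlongrightarrow> l i) F"
  shows "((\<lambda>x. MAX i\<in>X. f i x) \<longlongrightarrow> (MAX i\<in>X. l i)) F"
  using assms
proof (induction X rule: finite_ne_induct)
  case (insert i X)
  then show ?case by (auto intro!: tendsto_max)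
qed auto

lemma limit_plane_imp_hat_limit:
  assumes "limit_plane n \<Gamma> b"
  obtains S x where "hat_limit n \<Gamma> S" "plv n b = S *v x"
proof -
  obtain \<sigma> T' x where \<sigma>: "normal_seq n \<Gamma> \<sigma>" and T': "normalized_hat_limit n \<sigma> T'"
    and x: "\<forall>I\<in>psets n. plucker n b I = (\<Sum>J\<in>psets n. T' I J * x J)"
    using assms by (auto simp: limit_plane_def)
  obtain R where R: "\<And>\<nu>. R \<nu> \<in> hatcls n (\<sigma> \<nu>)"
    "\<And>I J. I \<in> psets n \<Longrightarrow> J \<in> psets n \<Longrightarrow> (\<lambda>\<nu>. R \<nu> I J) \<longlonglongrightarrow> T' I J"
    using T' by (auto simp: normalized_hat_limit_def)
  have "\<forall>\<nu>. \<exists>c A. c \<noteq> 0 \<and> A \<in> \<sigma> \<nu> \<and> R \<nu> = (\<lambda>I J. c * minor (Suc n) A I J)"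
    using R(1) unfolding hatcls_def by fast
  then obtain c A where cA: "\<And>\<nu>. c \<nu> \<noteq> 0" "\<And>\<nu>. A \<nu> \<in> \<sigma> \<nu>"
    "\<And>\<nu>. R \<nu> = (\<lambda>I J. c \<nu> * minor (Suc n) (A \<nu>) I J)" by metis
  define S where "S = (\<chi> I J. if I \<in> psets n \<and> J \<in> psets n then T' I J else 0)"
  have "(\<lambda>\<nu>. cscale (c \<nu>) (hat n (A \<nu>))) \<longlonglongrightarrow> S"
  proof (intro vec_tendstoI)
    fix I J
    show "(\<lambda>\<nu>. cscale (c \<nu>) (hat n (A \<nu>)) $ I $ J) \<longlonglongrightarrow> S $ I $ J"
      using R(2)[of I J] by (auto simp: S_def hat_def cA(3))
  qed
  then have "hat_limit n \<Gamma> S"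
    using \<sigma> cA by (intro hat_limitI) (auto simp: normal_seq_def)
  moreover have "plv n b = S *v (\<chi> J. x J)"
  proof -
    have "(\<Sum>J\<in>UNIV. S $ I $ J * x J) = (\<Sum>J\<in>psets n. S $ I $ J * x J)" for I
      by (intro sum.mono_neutral_right) (auto simp: S_def)
    then show ?thesis
      using x by (auto simp: vec_eq_iff matrix_vector_mult_def plv_def S_def)
  qed
  ultimately show thesis by (rule that)
qed

text \<open>As \<open>plv n b\<close> is nonzero, so is \<open>S\<close>, and the maximal entries of
  the approximating matrices tend to a positive number. Dividing by them restores the normalization
  and keeps convergence; a subsequence makes the group elements themselves converge.\<close>

lemma hat_limit_imp_limit_plane:
  fixes b :: "nat \<Rightarrow> 'k::{finite,linorder} cvec"
  assumes \<Gamma>: "\<Gamma> \<subseteq> PGL" and S: "hat_limit n \<Gamma> S" and b: "nplane_basis n b"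
    and plv: "plv n b = S *v x" and nz: "plv n b \<noteq> 0"
  shows "limit_plane n \<Gamma> b"
proof -
  obtain \<sigma> A c where s: "inj \<sigma>" "\<And>\<nu>. \<sigma> \<nu> \<in> \<Gamma>" "\<And>\<nu>. A \<nu> \<in> \<sigma> \<nu>" "\<And>\<nu>. c \<nu> \<noteq> 0"
    and lim: "(\<lambda>\<nu>. cscale (c \<nu>) (hat n (A \<nu>))) \<longlonglongrightarrow> S"
    using hat_limit_sequence[OF S] by blast
  let ?X = "psets n \<times> psets n :: ('k set \<times> 'k set) set"
  define mx :: "'k set cmat \<Rightarrow> real" where "mx M = (MAX z\<in>?X. cmod (M $ fst z $ snd z))" for M
  obtain I0 where "I0 \<in> psets n" "plucker n b I0 \<noteq> 0" by (rule plv_nonzeroE[OF nz])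
  then have ne: "?X \<noteq> {}" by auto
  have mx_ge: "cmod (M $ I $ J) \<le> mx M" if "I \<in> psets n" "J \<in> psets n" for M I J
    unfolding mx_def using that by (intro Max_ge image_eqI[of _ _ "(I, J)"]) auto
  have "(\<lambda>\<nu>. mx (cscale (c \<nu>) (hat n (A \<nu>)))) \<longlonglongrightarrow> mx S"
    unfolding mx_def using ne by (intro tendsto_MAX tendsto_norm tendsto_vec_nth lim) auto
  moreover have "mx S > 0"
  proof -
    have "S \<noteq> 0" using nz plv by auto
    then obtain I J where "S $ I $ J \<noteq> 0" by (auto simp: vec_eq_iff)
    moreover then have "I \<in> psets n" "J \<in> psets n" using hat_limit_support[OF S] by blast+
    ultimately show ?thesis using mx_ge[of I J S] by (metis less_le_trans zero_less_norm_iff)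
  qed
  ultimately have "\<forall>\<^sub>F \<nu> in sequentially. mx (cscale (c \<nu>) (hat n (A \<nu>))) > 0"
    by (rule order_tendstoD(1))
  then obtain m where m: "\<And>\<nu>. \<nu> \<ge> m \<Longrightarrow> mx (cscale (c \<nu>) (hat n (A \<nu>))) > 0"
    by (auto simp: eventually_sequentially)
  \<comment> \<open>The first \<open>m\<close> terms are dropped, so that every remaining maximum is
    positive and can be divided by.\<close>
  obtain r T where r: "strict_mono r" and T: "normalized_limit ((\<lambda>\<nu>. \<sigma> (\<nu> + m)) \<circ> r) T"
    using PGL_subseq_normalized_limit[of "\<lambda>\<nu>. \<sigma> (\<nu> + m)"] \<Gamma> s(2) by blast
  define q where "q \<nu> = r \<nu> + m" for \<nu>
  have q: "strict_mono q" using r by (auto simp: q_def strict_mono_def)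
  define \<mu> where "\<mu> \<nu> = mx (cscale (c (q \<nu>)) (hat n (A (q \<nu>))))" for \<nu>
  have \<mu>_pos: "\<mu> \<nu> > 0" for \<nu> by (simp add: \<mu>_def m q_def)
  define R where "R \<nu> = (\<lambda>I J. c (q \<nu>) / of_real (\<mu> \<nu>) * minor (Suc n) (A (q \<nu>)) I J)" for \<nu>
  define T' where "T' = (\<lambda>I J. S $ I $ J / of_real (mx S))"
  have R_eq: "R \<nu> I J = cscale (c (q \<nu>)) (hat n (A (q \<nu>))) $ I $ J / of_real (\<mu> \<nu>)"
    if "I \<in> psets n" "J \<in> psets n" for \<nu> I J
    using that by (simp add: R_def hat_def)
  have "normalized_hat_limit n (\<sigma> \<circ> q) T'"
    unfolding normalized_hat_limit_def
  proof (intro exI[of _ R] conjI allI ballI)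
    fix \<nu>
    show "R \<nu> \<in> hatcls n ((\<sigma> \<circ> q) \<nu>)"
      unfolding hatcls_def R_def using s(3,4) \<mu>_pos[of \<nu>]
      by (intro CollectI exI[of _ "c (q \<nu>) / of_real (\<mu> \<nu>)"] exI[of _ "A (q \<nu>)"]) auto
    have eq: "{cmod (R \<nu> I J) | I J. I \<in> psets n \<and> J \<in> psets n} = (\<lambda>z. cmod (R \<nu> (fst z) (snd z))) ` ?X"
      by (auto simp: image_def)
    have "\<mu> \<nu> \<in> (\<lambda>z. cmod (cscale (c (q \<nu>)) (hat n (A (q \<nu>))) $ fst z $ snd z)) ` ?X"
      unfolding \<mu>_def mx_def using ne by (intro Max_in) auto
    then obtain I J where IJ: "I \<in> psets n" "J \<in> psets n"
      "\<mu> \<nu> = cmod (cscale (c (q \<nu>)) (hat n (A (q \<nu>))) $ I $ J)" by auto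
    then have "cmod (R \<nu> I J) = 1" using \<mu>_pos[of \<nu>] by (simp only: R_eq norm_divide) simp
    moreover have "cmod (R \<nu> I' J') \<le> 1" if "I' \<in> psets n" "J' \<in> psets n" for I' J'
      using mx_ge[OF that, of "cscale (c (q \<nu>)) (hat n (A (q \<nu>)))"] \<mu>_pos[of \<nu>]
      by (simp only: R_eq[OF that] norm_divide) (simp add: \<mu>_def[symmetric])
    ultimately show "Max {cmod (R \<nu> I J) | I J. I \<in> psets n \<and> J \<in> psets n} = 1"
      unfolding eq using IJ by (intro Max_eqI) (auto simp: image_iff)
  next
    fix I J :: "'k set" assume IJ: "I \<in> psets n" "J \<in> psets n"
    have lq: "(\<lambda>\<nu>. cscale (c (q \<nu>)) (hat n (A (q \<nu>)))) \<longlonglongrightarrow> S"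
      using LIMSEQ_subseq_LIMSEQ[OF lim q] by (simp add: o_def)
    have "\<mu> \<longlonglongrightarrow> mx S"
      unfolding \<mu>_def unfolding mx_def using ne by (intro tendsto_MAX tendsto_norm tendsto_vec_nth lq) auto
    then have "(\<lambda>\<nu>. cscale (c (q \<nu>)) (hat n (A (q \<nu>))) $ I $ J / of_real (\<mu> \<nu>)) \<longlonglongrightarrow> T' I J"
      unfolding T'_def using \<open>mx S > 0\<close> by (intro tendsto_divide tendsto_of_real tendsto_vec_nth lq) auto
    then show "(\<lambda>\<nu>. R \<nu> I J) \<longlonglongrightarrow> T' I J" by (simp only: R_eq[OF IJ])
  qed
  moreover have "normal_seq n \<Gamma> (\<sigma> \<circ> q)"
  proof -
    have "(\<lambda>\<nu>. \<sigma> (\<nu> + m)) \<circ> r = \<sigma> \<circ> q" by (auto simp: q_def)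
    then have "normalized_limit (\<sigma> \<circ> q) T" using T by simp
    moreover have "inj (\<sigma> \<circ> q)" using s(1) q strict_mono_imp_inj_on by (intro inj_compose) auto
    ultimately show ?thesis
      unfolding normal_seq_def using s(2) \<open>normalized_hat_limit n (\<sigma> \<circ> q) T'\<close> by auto
  qed
  \<comment> \<open>The coefficients absorb the factor \<open>mx S\<close> by which
    \<open>T'\<close> was divided.\<close>
  moreover have "plucker n b I = (\<Sum>J\<in>psets n. T' I J * (of_real (mx S) * x $ J))" if I: "I \<in> psets n" for I
  proof -
    have "plucker n b I = (\<Sum>J\<in>UNIV. S $ I $ J * x $ J)"
      using arg_cong[OF plv, of "\<lambda>v. v $ I"] I by (simp add: plv_def matrix_vector_mult_def)
    also have "\<dots> = (\<Sum>J\<in>psets n. S $ I $ J * x $ J)"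
      using hat_limit_support[OF S] by (intro sum.mono_neutral_right) auto
    finally show ?thesis using \<open>mx S > 0\<close> by (simp add: T'_def)
  qed
  ultimately show ?thesis
    unfolding limit_plane_def using b by (intro conjI exI[of _ "\<sigma> \<circ> q"] exI[of _ T'] exI[of _ "\<lambda>J. of_real (mx S) * x $ J"]) auto
qed

section \<open>Limit maps have rank one\<close>

text \<open>Injectivity of the Pluecker embedding: reduced bases depend only on ratios of
  coordinates.\<close>

lemma pspan_eq_if_plv_proportional:
  assumes eq: "plv n b = k *s plv n b'" and nz: "plv n b \<noteq> 0"
  shows "pspan n b = pspan n b'"
proof -
  obtain I where I: "I \<in> psets n" "plucker n b I \<noteq> 0" by (rule plv_nonzeroE[OF nz])
  have p: "tdet n b f = k * tdet n b' f" for f by (rule tdet_scale[OF eq])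
  then have k: "k \<noteq> 0" "plucker n b' I \<noteq> 0" using I(2) by (auto simp: plucker_eq_tdet)
  have nf: "nf n b I = nf n b' I"
    using k by (simp add: fun_eq_iff vec_eq_iff nf_def plucker_eq_tdet p)
  show ?thesis
    by (rule set_eqI) (simp only: mem_pspan_iff_nf[OF I(2)] mem_pspan_iff_nf[OF k(2)] nf)
qed

lemma vector_smult_eq_scaleR: "r *\<^sub>R x = complex_of_real r *s x" for x :: "'k::finite cvec"
  by (simp add: vec_eq_iff) (simp add: scaleR_conv_of_real)

lemma norm_cmult_vec: "norm (c *s x) = cmod c * norm x" for x :: "'k::finite cvec"
  by (simp add: norm_vec_def norm_mult L2_set_def power_mult_distrib sum_distrib_left[symmetric] real_sqrt_mult)

text \<open>Pulled back by the inverse of \<open>A\<close>, the n-plane still has linear dimension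
  n+1, while the whole pencil spans dimension n+2; together this exceeds 2n+2. A common vector lies
  in one member of the pencil, whose parameters are normalized with a view to compactness.\<close>

lemma nplane_meets_pencil:
  fixes b0 c :: "nat \<Rightarrow> 'k::{finite,linorder} cvec"
  assumes card: "CARD('k) = 2 * n + 2" and A: "invertible A" and b0: "nplane_basis n b0"
    and s: "s < Suc n" and c1: "nplane_basis n (c(s := v1))" and v2: "v2 \<notin> pspan n (c(s := v1))"
  shows "\<exists>x \<alpha> \<beta>. norm x = 1 \<and> x \<in> pspan n b0 \<and> norm (\<alpha>, \<beta>) = 1 \<and>
    x \<in> pspan n (\<lambda>t. A *v (c(s := \<alpha> *s v1 + \<beta> *s v2)) t)"
proof -
  define B where "B = matrix_inv A"
  have AB: "A ** B = mat 1" and iB: "invertible B"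
    using matrix_inv_works[OF A] by (auto simp: B_def invertible_def)
  let ?c1 = "c(s := v1)"
  let ?S = "pspan n (\<lambda>t. B *v b0 t)"
  let ?T = "vec.span (insert v2 (?c1 ` {..<Suc n}))"
  have "plv n b0 \<noteq> 0" using b0 card by (intro nplane_basis_plv_nonzero) auto
  then have "plv n (\<lambda>t. B *v b0 t) \<noteq> 0" by (rule plv_mult_invertible_nonzero[OF iB])
  then have dS: "vec.dim ?S = Suc n" by (intro dim_pspan nplane_basis_if_plv_nonzero)
  have dT: "vec.dim ?T = Suc (Suc n)"
    using v2 dim_pspan[OF c1] by (simp only: vec.dim_span vec.dim_insert pspan_eq_span) simp
  have "vec.dim {x + y | x y. x \<in> ?S \<and> y \<in> ?T} + vec.dim (?S \<inter> ?T) = vec.dim ?S + vec.dim ?T"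
    by (intro vec.dim_sums_Int subspace_pspan vec.subspace_span)
  moreover have "vec.dim {x + y | x y. x \<in> ?S \<and> y \<in> ?T} \<le> CARD('k)"
    by (rule order_trans[OF vec.dim_subset[OF subset_UNIV]]) (simp only: vec_dim_card order_refl)
  ultimately have "vec.dim (?S \<inter> ?T) \<noteq> 0" using dS dT card by linarith
  then have "\<not> ?S \<inter> ?T \<subseteq> {0}" by (simp only: vec.dim_eq_0 not_False_eq_True)
  then obtain y where y: "y \<in> ?S" "y \<in> ?T" "y \<noteq> 0" by blast
  obtain k where k: "y - k *s v2 \<in> pspan n ?c1"
    using y(2) unfolding vec.span_insert pspan_eq_span by blast
  then obtain a where a: "y - k *s v2 = (\<Sum>t<Suc n. a t *s ?c1 t)" by (auto simp: pspan_def)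
  have "(\<Sum>t<Suc n. a t *s ?c1 t) = a s *s v1 + (\<Sum>t\<in>{..<Suc n}-{s}. a t *s ?c1 t)"
    using s by (subst sum.remove[of _ s]) (auto simp del: sum.lessThan_Suc)
  also have "(\<Sum>t\<in>{..<Suc n}-{s}. a t *s ?c1 t) = (\<Sum>t\<in>{..<Suc n}-{s}. a t *s c t)"
    by (intro sum.cong) auto
  finally have y_eq: "y = (a s *s v1 + k *s v2) + (\<Sum>t\<in>{..<Suc n}-{s}. a t *s c t)"
    using a by (simp add: algebra_simps)
  \<comment> \<open>If both coefficients vanish, the vector lies in the axis common to all members;
    any unit parameter will do, with \<rho> = 0.\<close>
  obtain \<rho> \<alpha> \<beta> where ab: "norm (\<alpha>, \<beta>) = 1" "\<rho> * \<alpha> = a s" "\<rho> * \<beta> = k"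
  proof (cases "a s = 0 \<and> k = 0")
    case True
    then show thesis using that[of 1 0 0] by (simp add: norm_Pair)
  next
    case False
    define r where "r = norm (a s, k)"
    have "r > 0" using False by (auto simp: r_def zero_prod_def)
    have "norm (a s / of_real r, k / of_real r) = norm (inverse r *\<^sub>R (a s, k))"
      by (simp add: scaleR_conv_of_real divide_inverse mult.commute)
    also have "\<dots> = 1" using \<open>r > 0\<close> by (simp only: norm_scaleR) (simp add: r_def)
    finally show thesis using \<open>r > 0\<close> by (intro that[of "a s / of_real r" "k / of_real r" "of_real r"]) auto
  qed
  let ?c = "c(s := \<alpha> *s v1 + \<beta> *s v2)"
  have "y = (\<Sum>t<Suc n. (a(s := \<rho>)) t *s ?c t)"
  proof -
    have "(\<Sum>t<Suc n. (a(s := \<rho>)) t *s ?c t)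
        = \<rho> *s (\<alpha> *s v1 + \<beta> *s v2) + (\<Sum>t\<in>{..<Suc n}-{s}. (a(s := \<rho>)) t *s ?c t)"
      using s by (subst sum.remove[of _ s]) (auto simp del: sum.lessThan_Suc)
    also have "(\<Sum>t\<in>{..<Suc n}-{s}. (a(s := \<rho>)) t *s ?c t) = (\<Sum>t\<in>{..<Suc n}-{s}. a t *s c t)"
      by (intro sum.cong) auto
    also have "\<rho> *s (\<alpha> *s v1 + \<beta> *s v2) = a s *s v1 + k *s v2"
      by (simp only: vector_add_ldistrib vector_smult_assoc ab(2,3))
    finally show ?thesis by (simp only: y_eq)
  qed
  then have "y \<in> pspan n ?c" unfolding pspan_def by (intro CollectI exI)
  then have Ay1: "A *v y \<in> pspan n (\<lambda>t. A *v ?c t)" by (simp only: pspan_mult imageI)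
  have Ay2: "A *v y \<in> pspan n b0"
    using y(1) by (auto simp: pspan_mult matrix_vector_mul_assoc AB)
  have Ay0: "A *v y \<noteq> 0"
  proof
    assume "A *v y = 0"
    then have "B *v (A *v y) = 0" by simp
    then show False using y(3) by (simp add: matrix_vector_mul_assoc B_def matrix_inv_works(2)[OF A])
  qed
  define x where "x = of_real (inverse (norm (A *v y))) *s (A *v y)"
  have "norm x = 1" using Ay0 by (simp add: x_def norm_cmult_vec norm_inverse)
  moreover have "x \<in> pspan n b0" "x \<in> pspan n (\<lambda>t. A *v ?c t)"
    unfolding x_def using Ay1 Ay2 subspace_pspan vec.subspace_scale by blast+
  ultimately show ?thesis using ab(1) by blast
qed

lemma closed_pspan: "closed (pspan n b)"
proof (rule closed_subspace)
  show "subspace (pspan n b)"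
    using subspace_pspan[of n b] unfolding vec.subspace_def subspace_def
    by (metis vector_smult_eq_scaleR)
qed

text \<open>The affine cone over the limit set.\<close>
definition limit_cone :: "nat \<Rightarrow> ('k::{finite,linorder} cmat) set set \<Rightarrow> 'k cvec set" where
  "limit_cone n \<Gamma> = {v. v = 0 \<or> (\<exists>b. limit_plane n \<Gamma> b \<and> v \<in> pspan n b)}"

lemma limit_cone_scale: "v \<in> limit_cone n \<Gamma> \<Longrightarrow> c *s v \<in> limit_cone n \<Gamma>"
  unfolding limit_cone_def using vec.subspace_scale[OF subspace_pspan] by fastforce

text \<open>A nonzero limit of decomposable vectors is decomposable, and here it lies in the image
  of \<open>S\<close>. So the limiting n-plane is a limit n-plane, and it contains the limits of
  points.\<close>

lemma limit_point_in_limit_cone: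
  fixes b :: "nat \<Rightarrow> nat \<Rightarrow> 'k::{finite,linorder} cvec"
  assumes \<Gamma>: "\<Gamma> \<subseteq> PGL" and S: "hat_limit n \<Gamma> S"
    and lim: "(\<lambda>j. c j *s plv n (b j)) \<longlonglongrightarrow> S *v w" and nz: "S *v w \<noteq> 0"
    and x: "x \<longlonglongrightarrow> y" "\<And>j. x j \<in> pspan n (b j)"
  shows "y \<in> limit_cone n \<Gamma>"
proof -
  obtain b' where b': "nplane_basis n b'" "plv n b' = S *v w" "y \<in> pspan n b'"
    using plucker_limit[OF lim nz] x by blast
  then have "limit_plane n \<Gamma> b'" using hat_limit_imp_limit_plane[OF \<Gamma> S] nz by auto
  with b'(3) show ?thesis by (auto simp: limit_cone_def)
qed

text \<open>Otherwise the images of the n-planes of the pencil spanned by v1 and v2 fill (n+2)-dimensional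
  subspaces of C^(2n+2). Each of these meets the n-plane b0, and the intersection points accumulate at
  a point of b0 lying on the limit of a convergent sequence of members of the pencils.\<close>
lemma pencil_limit_dependent:
  fixes b0 c :: "nat \<Rightarrow> 'k::{finite,linorder} cvec"
  assumes card: "CARD('k) = 2 * n + 2" and \<Gamma>: "\<Gamma> \<subseteq> PGL"
    and b0: "nplane_basis n b0" and disj: "pspan n b0 \<inter> limit_cone n \<Gamma> \<subseteq> {0}"
    and S: "hat_limit n \<Gamma> S" and s: "s < Suc n"
  shows "\<exists>\<alpha> \<beta>. (\<alpha> \<noteq> 0 \<or> \<beta> \<noteq> 0) \<and> S *v plv n (c(s := \<alpha> *s v1 + \<beta> *s v2)) = 0"
proof (rule ccontr)
  assume "\<not> ?thesis"
  then have ind: "S *v plv n (c(s := \<alpha> *s v1 + \<beta> *s v2)) \<noteq> 0" if "\<alpha> \<noteq> 0 \<or> \<beta> \<noteq> 0" for \<alpha> \<beta>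
    using that by blast
  obtain \<sigma> A k where s\<sigma>: "inj \<sigma>" "\<And>\<nu>. \<sigma> \<nu> \<in> \<Gamma>" "\<And>\<nu>. A \<nu> \<in> \<sigma> \<nu>" "\<And>\<nu>. k \<nu> \<noteq> 0"
    and lim: "(\<lambda>\<nu>. cscale (k \<nu>) (hat n (A \<nu>))) \<longlonglongrightarrow> S"
    using hat_limit_sequence[OF S] by blast
  have inv: "invertible (A \<nu>)" for \<nu> using \<Gamma> s\<sigma>(2,3) PGL_invertible by blast
  have "plv n (c(s := v1)) \<noteq> 0" using ind[of 1 0] by auto
  then have c1: "nplane_basis n (c(s := v1))" by (rule nplane_basis_if_plv_nonzero)
  \<comment> \<open>Otherwise replacing \<open>v1\<close> by \<open>v2\<close> would multiply the
    Pluecker vector by \<open>a s\<close>, and the combination with parameters \<open>a s\<close>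
    and -1 would have Pluecker vector 0.\<close>
  have v2: "v2 \<notin> pspan n (c(s := v1))"
  proof
    assume "v2 \<in> pspan n (c(s := v1))"
    then obtain a where "v2 = (\<Sum>t<Suc n. a t *s (c(s := v1)) t)" by (auto simp: pspan_def)
    with plv_upd_lincomb[OF s, of "c(s := v1)" a]
    have "plv n (c(s := v2)) = a s *s plv n (c(s := v1))" by (simp del: sum.lessThan_Suc)
    then have "plv n (c(s := a s *s v1 + (-1) *s v2)) = 0"
      by (simp only: plv_lincomb2[OF s]) simp
    then show False using ind[of "a s" "-1"] by simp
  qed
  have "\<exists>x \<alpha> \<beta>. norm x = 1 \<and> x \<in> pspan n b0 \<and> norm (\<alpha>, \<beta>) = 1 \<and>
    x \<in> pspan n (\<lambda>t. A \<nu> *v (c(s := \<alpha> *s v1 + \<beta> *s v2)) t)" for \<nu>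
    by (rule nplane_meets_pencil[OF card inv b0 s c1 v2])
  then have "\<exists>z. norm (fst z) = 1 \<and> fst z \<in> pspan n b0 \<and> norm (snd z) = 1 \<and>
    fst z \<in> pspan n (\<lambda>t. A \<nu> *v (c(s := fst (snd z) *s v1 + snd (snd z) *s v2)) t)" for \<nu>
    by (metis fst_conv snd_conv)
  then obtain z where z: "\<And>\<nu>. norm (fst (z \<nu>)) = 1" "\<And>\<nu>. fst (z \<nu>) \<in> pspan n b0"
    "\<And>\<nu>. norm (snd (z \<nu>)) = 1"
    "\<And>\<nu>. fst (z \<nu>) \<in> pspan n (\<lambda>t. A \<nu> *v (c(s := fst (snd (z \<nu>)) *s v1 + snd (snd (z \<nu>)) *s v2)) t)"
    by metis
  have "bounded (range z)"
  proof -
    have "z \<nu> \<in> sphere 0 1 \<times> sphere 0 1" for \<nu> by (simp add: mem_Times_iff z(1,3))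
    then have "range z \<subseteq> sphere 0 1 \<times> sphere 0 1" by blast
    then show ?thesis by (rule bounded_subset[rotated]) (intro bounded_Times bounded_sphere)
  qed
  then obtain l r where r: "strict_mono r" "(z \<circ> r) \<longlonglongrightarrow> l"
    using bounded_imp_convergent_subsequence by blast
  define \<alpha> where "\<alpha> = fst (snd l)"
  define \<beta> where "\<beta> = snd (snd l)"
  have lx: "(\<lambda>j. fst (z (r j))) \<longlonglongrightarrow> fst l" and ls: "(\<lambda>j. snd (z (r j))) \<longlonglongrightarrow> snd l"
    using tendsto_fst[OF r(2)] tendsto_snd[OF r(2)] by (simp_all add: o_def)
  \<comment> \<open>Unit length survives the limit twice: for the parameters it keeps the image of
    the limiting member under \<open>S\<close> nonzero, for the point it gives the final
    contradiction.\<close>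
  have "norm (fst l) = 1" "norm (snd l) = 1"
    using LIMSEQ_unique[OF tendsto_norm[OF lx]] LIMSEQ_unique[OF tendsto_norm[OF ls]]
    by (simp_all add: z(1,3))
  then have "\<alpha> \<noteq> 0 \<or> \<beta> \<noteq> 0" by (cases "snd l") (auto simp: \<alpha>_def \<beta>_def)
  note nz = ind[OF this]
  let ?c = "\<lambda>j. c(s := fst (snd (z j)) *s v1 + snd (snd (z j)) *s v2)"
  have lc: "(\<lambda>j. ?c (r j) t) \<longlonglongrightarrow> (c(s := \<alpha> *s v1 + \<beta> *s v2)) t" for t
  proof (cases "t = s")
    case True
    have "(\<lambda>j. fst (snd (z (r j))) *s v1 + snd (snd (z (r j))) *s v2) \<longlonglongrightarrow> \<alpha> *s v1 + \<beta> *s v2"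
      unfolding \<alpha>_def \<beta>_def
      by (rule vec_tendstoI, unfold vector_add_component vector_smult_component)
         (intro tendsto_add tendsto_mult tendsto_const tendsto_fst tendsto_snd ls)
    then show ?thesis using True by simp
  qed simp
  have lim': "(\<lambda>j. cscale (k (r j)) (hat n (A (r j)))) \<longlonglongrightarrow> S"
    using LIMSEQ_subseq_LIMSEQ[OF lim r(1)] by (simp add: o_def)
  have "(\<lambda>j. k (r j) *s plv n (\<lambda>t. A (r j) *v ?c (r j) t)) \<longlonglongrightarrow> S *v plv n (c(s := \<alpha> *s v1 + \<beta> *s v2))"
    using tendsto_mult_vec[OF lim' tendsto_plv[of n "\<lambda>j. ?c (r j)", OF lc]]
    by (simp only: cscale_mult_vec cauchy_binet_plv)
  from limit_point_in_limit_cone[OF \<Gamma> S this nz lx z(4)]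
  have "fst l \<in> limit_cone n \<Gamma>" .
  moreover have "fst l \<in> pspan n b0"
    by (rule closed_sequentially[OF closed_pspan z(2) lx])
  ultimately have "fst l = 0" using disj by blast
  then show False using \<open>norm (fst l) = 1\<close> by simp
qed

text \<open>Each of the two affine lines passes through 0 for at most one \<open>t\<close>. The
  hypotheses are asymmetric because, when tuples are joined, one nonzero image sits at
  \<open>t\<close> = 0 and the other is the direction of its line.\<close>

lemma ex_avoiding_roots:
  fixes p q p' q' :: "(complex, 'm::finite) vec"
  assumes "p \<noteq> 0" "q' \<noteq> 0"
  shows "\<exists>t. p + t *s q \<noteq> 0 \<and> p' + t *s q' \<noteq> 0"
proof (rule ccontr)
  assume "\<not> ?thesis"
  then have *: "p + t *s q = 0 \<or> p' + t *s q' = 0" for t by blast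
  obtain i where i: "p $ i \<noteq> 0" using assms(1) by (auto simp: vec_eq_iff)
  obtain j where j: "q' $ j \<noteq> 0" using assms(2) by (auto simp: vec_eq_iff)
  have "p $ i + t * q $ i = 0 \<or> p' $ j + t * q' $ j = 0" for t
    using *[of t] by (auto simp: vec_eq_iff)
  moreover have "t = - (p $ i / q $ i)" if "p $ i + t * q $ i = 0" for t
    using that i by (cases "q $ i = 0") (auto simp: field_simps add_eq_0_iff)
  moreover have "t = - (p' $ j / q' $ j)" if "p' $ j + t * q' $ j = 0" for t
    using that j by (auto simp: field_simps add_eq_0_iff)
  ultimately have "t = - (p $ i / q $ i) \<or> t = - (p' $ j / q' $ j)" for t
    by blast
  then have "UNIV \<subseteq> {- (p $ i / q $ i), - (p' $ j / q' $ j)}" by auto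
  then have "finite (UNIV :: complex set)" using finite_subset by blast
  then show False using infinite_UNIV_char_0 by blast
qed

section \<open>Joining and perturbing tuples entry by entry\<close>

definition splice_at :: "nat \<Rightarrow> (nat \<Rightarrow> 'a) \<Rightarrow> (nat \<Rightarrow> 'a) \<Rightarrow> nat \<Rightarrow> 'a" where
  "splice_at k c a = (\<lambda>s. if s < k then c s else a s)"

lemma splice_at_0 [simp]: "splice_at 0 c a = a"
  by (simp add: splice_at_def)

lemma splice_at_Suc: "splice_at (Suc k) (c(k := z)) a = (splice_at k c a)(k := z)"
  by (auto simp: splice_at_def fun_eq_iff)

lemma splice_at_upd_self: "(splice_at k c a)(k := a k) = splice_at k c a"
  by (auto simp: splice_at_def fun_eq_iff)

lemma plv_splice_full: "plv n (splice_at (Suc n) c a) = plv n c"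
  by (rule plv_cong) (simp add: splice_at_def)

text \<open>Two tuples a and b with nonzero image are joined by replacing their entries one at a time by a
  common generic combination of a k and b k, which keeps both images nonzero.\<close>
lemma limit_images_proportional:
  fixes S :: "('k::{finite,linorder}) set cmat"
  assumes dep: "\<And>s c v1 v2. s < Suc n \<Longrightarrow>
      \<exists>\<alpha> \<beta>. (\<alpha> \<noteq> 0 \<or> \<beta> \<noteq> 0) \<and> S *v plv n (c(s := \<alpha> *s v1 + \<beta> *s v2)) = 0"
    and a: "S *v plv n a \<noteq> 0"
  shows "\<exists>\<mu>. S *v plv n b = \<mu> *s (S *v plv n a)"
proof (cases "S *v plv n b = 0")
  case True
  then show ?thesis by (intro exI[of _ 0]) simp
next
  case b: False
  let ?F = "\<lambda>c. S *v plv n c"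
  have F2: "?F (c(s := x *s u + y *s w)) = x *s ?F (c(s := u)) + y *s ?F (c(s := w))"
    if "s < Suc n" for c s x y u w
    by (simp add: plv_lincomb2[OF that] matrix_vector_right_distrib vec.scale)
  \<comment> \<open>For tuples that differ in one entry, the vanishing combination from
    \<open>dep\<close> relates the two images.\<close>
  have par: "\<exists>m. ?F (c(s := u)) = m *s ?F (c(s := w))"
    if s: "s < Suc n" and u: "?F (c(s := u)) \<noteq> 0" and w: "?F (c(s := w)) \<noteq> 0" for c s u w
  proof -
    obtain x y where xy: "x \<noteq> 0 \<or> y \<noteq> 0" "?F (c(s := x *s u + y *s w)) = 0"
      using dep[OF s] by metis
    then have e: "x *s ?F (c(s := u)) + y *s ?F (c(s := w)) = 0" by (simp only: F2[OF s])
    have "x \<noteq> 0"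
    proof
      assume "x = 0"
      then have "y \<noteq> 0" "y *s ?F (c(s := w)) = 0" using xy(1) e by simp_all
      then show False using w by (simp add: vec_eq_iff)
    qed
    then have "?F (c(s := u)) = (- y / x) *s ?F (c(s := w))"
      using e by (auto simp: vec_eq_iff field_simps add_eq_0_iff)
    then show ?thesis by blast
  qed
  \<comment> \<open>At stage \<open>k\<close> the first \<open>k\<close> entries of both tuples are
    common, both images are nonzero, and the original images are multiples of the current ones. At
    \<open>k = Suc n\<close> the tuples agree.\<close>
  have "\<exists>c m m'. ?F (splice_at k c a) \<noteq> 0 \<and> ?F (splice_at k c b) \<noteq> 0 \<and>
      ?F a = m *s ?F (splice_at k c a) \<and> ?F b = m' *s ?F (splice_at k c b)" if "k \<le> Suc n" for k
    using that
  proof (induction k)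
    case 0
    then show ?case using a b by (intro exI[of _ a] exI[of _ 1]) simp
  next
    case (Suc k)
    then have k: "k < Suc n" by simp
    obtain c m m' where IH: "?F (splice_at k c a) \<noteq> 0" "?F (splice_at k c b) \<noteq> 0"
      "?F a = m *s ?F (splice_at k c a)" "?F b = m' *s ?F (splice_at k c b)"
      using Suc.IH k by auto
    let ?U = "splice_at k c a" and ?W = "splice_at k c b"
    obtain t where t: "?F ?U + t *s ?F (?U(k := b k)) \<noteq> 0" "?F (?W(k := a k)) + t *s ?F ?W \<noteq> 0"
      using ex_avoiding_roots[OF IH(1,2)] by blast
    define z where "z = 1 *s a k + t *s b k"
    have U: "?F (?U(k := z)) = ?F ?U + t *s ?F (?U(k := b k))"
      unfolding z_def F2[OF k] by (simp add: splice_at_upd_self)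
    have W: "?F (?W(k := z)) = ?F (?W(k := a k)) + t *s ?F ?W"
      unfolding z_def F2[OF k] by (simp add: splice_at_upd_self)
    obtain u where u: "?F ?U = u *s ?F (?U(k := z))"
      using par[OF k, of ?U "a k" z] IH(1) t(1) by (auto simp: splice_at_upd_self U)
    obtain w where w: "?F ?W = w *s ?F (?W(k := z))"
      using par[OF k, of ?W "b k" z] IH(2) t(2) by (auto simp: splice_at_upd_self W)
    show ?case
    proof (intro exI conjI)
      show "?F (splice_at (Suc k) (c(k := z)) a) \<noteq> 0" using t(1) by (simp only: splice_at_Suc U not_False_eq_True)
      show "?F (splice_at (Suc k) (c(k := z)) b) \<noteq> 0" using t(2) by (simp only: splice_at_Suc W not_False_eq_True)
      show "?F a = (m * u) *s ?F (splice_at (Suc k) (c(k := z)) a)"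
        using IH(3) u by (simp only: splice_at_Suc vector_smult_assoc[symmetric])
      show "?F b = (m' * w) *s ?F (splice_at (Suc k) (c(k := z)) b)"
        using IH(4) w by (simp only: splice_at_Suc vector_smult_assoc[symmetric])
    qed
  qed
  from this[of "Suc n"] obtain c m m' where "?F a = m *s ?F c" "?F b = m' *s ?F c"
    by (auto simp: plv_splice_full)
  moreover then have "m \<noteq> 0" using a by auto
  ultimately have "?F b = (m' / m) *s ?F a" by (simp add: vector_smult_assoc)
  then show ?thesis by blast
qed

lemma ex_small_avoiding_root:
  fixes p q :: "(complex, 'm::finite) vec"
  assumes "q \<noteq> 0" "(\<delta>::real) > 0"
  shows "\<exists>t. cmod t \<le> \<delta> \<and> p + t *s q \<noteq> 0"
proof (rule ccontr)
  assume "\<not> ?thesis"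
  then have "p + of_real \<delta> *s q = 0" "p + 0 *s q = 0"
    using assms(2) by (metis norm_of_real abs_of_pos order_refl, metis norm_zero less_imp_le)
  then have "of_real \<delta> *s q = 0" by simp
  then show False using assms by (auto simp: vec_eq_iff)
qed

text \<open>Entry by entry, \<open>b k\<close> is perturbed by a small multiple of
  \<open>a k\<close>. The image of the current tuple, which still has \<open>a k\<close> in place,
  is nonzero and is the direction of the perturbation, so at most one multiple fails.\<close>

lemma nonvanishing_dense:
  fixes S :: "('k::{finite,linorder}) set cmat" and b :: "nat \<Rightarrow> 'k cvec"
  assumes a: "S *v plv n a \<noteq> 0" and e: "e > 0"
  shows "\<exists>c. (\<forall>s<Suc n. dist (c s) (b s) < e) \<and> S *v plv n c \<noteq> 0"
proof -
  let ?F = "\<lambda>c. S *v plv n c"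
  have "\<exists>c. (\<forall>s<k. dist (c s) (b s) < e) \<and> ?F (splice_at k c a) \<noteq> 0" if "k \<le> Suc n" for k
    using that
  proof (induction k)
    case 0
    then show ?case using a by simp
  next
    case (Suc k)
    then have k: "k < Suc n" by simp
    obtain c where IH: "\<forall>s<k. dist (c s) (b s) < e" "?F (splice_at k c a) \<noteq> 0"
      using Suc.IH k by auto
    let ?U = "splice_at k c a"
    \<comment> \<open>The summand 1 keeps the denominator positive when
      \<open>a k = 0\<close>.\<close>
    define \<delta> where "\<delta> = e / (norm (a k) + 1)"
    have \<delta>: "\<delta> > 0" using e by (simp add: \<delta>_def add_nonneg_pos)
    obtain t where t: "cmod t \<le> \<delta>" "?F (?U(k := b k)) + t *s ?F ?U \<noteq> 0"
      using ex_small_avoiding_root[OF IH(2) \<delta>] by blast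
    define z where "z = 1 *s b k + t *s a k"
    have "?F (?U(k := z)) = ?F (?U(k := b k)) + t *s ?F ?U"
      by (simp add: z_def plv_lincomb2[OF k, where x = 1, simplified] matrix_vector_right_distrib vec.scale splice_at_upd_self)
    then have "?F (splice_at (Suc k) (c(k := z)) a) \<noteq> 0"
      using t(2) by (simp only: splice_at_Suc not_False_eq_True)
    moreover have "dist z (b k) < e"
    proof -
      have "dist z (b k) = cmod t * norm (a k)" by (simp add: z_def dist_norm norm_cmult_vec)
      also have "\<dots> \<le> \<delta> * norm (a k)" using t(1) by (intro mult_right_mono) auto
      also have "\<dots> < \<delta> * (norm (a k) + 1)" using \<delta> by simp
      also have "\<dots> = e"
        using add_nonneg_pos[OF norm_ge_zero zero_less_one, of "a k"] by (simp add: \<delta>_def)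
      finally show ?thesis .
    qed
    then have "\<forall>s<Suc k. dist ((c(k := z)) s) (b s) < e" using IH(1) by (auto simp: less_Suc_eq)
    ultimately show ?case by blast
  qed
  from this[of "Suc n"] show ?thesis by (auto simp: plv_splice_full)
qed

section \<open>The limit cone\<close>

text \<open>Type L in terms of cones: 0 belongs to every cone, so an n-plane outside the limit set
  is one that meets \<open>limit_cone\<close> at most in 0.\<close>

locale nplane_off_limit_cone =
  fixes n :: nat and \<Gamma> :: "('k::{finite,linorder} cmat) set set" and b0 :: "nat \<Rightarrow> 'k cvec"
  assumes card: "CARD('k) = 2 * n + 2"
    and discrete: "discrete_subgroup \<Gamma>"
    and b0: "nplane_basis n b0"
    and disj: "pspan n b0 \<inter> limit_cone n \<Gamma> \<subseteq> {0}"
begin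

lemma \<Gamma>_PGL: "\<Gamma> \<subseteq> PGL"
  using discrete by (simp add: discrete_subgroup_def)

lemma plv_basis_nonzero: "nplane_basis n b \<Longrightarrow> plv n b \<noteq> 0" for b :: "nat \<Rightarrow> 'k cvec"
  using card by (intro nplane_basis_plv_nonzero) auto

lemma images_proportional:
  assumes S: "hat_limit n \<Gamma> S" and "S *v plv n a \<noteq> 0"
  shows "\<exists>\<mu>. S *v plv n c = \<mu> *s (S *v plv n a)"
  using pencil_limit_dependent[OF card \<Gamma>_PGL b0 disj S] assms(2)
  by (intro limit_images_proportional) auto

lemma hat_limit_nonzero_image:
  assumes S: "hat_limit n \<Gamma> S" and x: "S *v x \<noteq> 0"
  shows "\<exists>a. S *v plv n a \<noteq> 0"
proof (rule ccontr)
  assume "\<not> ?thesis"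
  then have "S *v plv n a = 0" for a by blast
  then have "S *v x = 0" by (subst hat_limit_mult_vec[OF S]) simp
  with x show False by simp
qed

text \<open>All decomposable vectors go to multiples of one vector, hence so does every vector;
  \<open>plv n b\<close>, a nonzero element of the image of \<open>S\<close>, therefore spans it.
  This recovers the n-plane \<open>b\<close> from any decomposable vector that \<open>S\<close> does
  not kill.\<close>

lemma image_proportional_limit_plane:
  assumes S: "hat_limit n \<Gamma> S" and b: "plv n b = S *v x" "plv n b \<noteq> 0"
  shows "\<exists>\<mu>. S *v plv n c = \<mu> *s plv n b"
proof -
  obtain a where a: "S *v plv n a \<noteq> 0"
    using hat_limit_nonzero_image[OF S, of x] b by auto
  have "\<exists>m. \<forall>c. S *v plv n c = m c *s (S *v plv n a)"
    using images_proportional[OF S a] by metis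
  then obtain m where m: "\<And>c. S *v plv n c = m c *s (S *v plv n a)" by blast
  define k where "k = (\<Sum>J\<in>psets n. x $ J * m (\<lambda>s. column (enum_set J s) (mat 1)))"
  have "plv n b = (\<Sum>J\<in>psets n. x $ J *s (m (\<lambda>s. column (enum_set J s) (mat 1)) *s (S *v plv n a)))"
    unfolding b(1) by (subst hat_limit_mult_vec[OF S]) (rule sum.cong[OF refl], subst m, rule refl)
  then have k: "plv n b = k *s (S *v plv n a)"
    by (simp only: k_def vector_smult_assoc vec.scale_sum_left)
  with b(2) have "k \<noteq> 0" by auto
  then have "S *v plv n a = inverse k *s plv n b" by (simp add: k vector_smult_assoc)
  with m[of c] show ?thesis by (auto simp: vector_smult_assoc)
qed

lemma closed_limit_cone: "closed (limit_cone n \<Gamma>)"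
  unfolding closed_sequential_limits
proof (intro allI impI, elim conjE)
  fix v l assume v: "\<forall>j. v j \<in> limit_cone n \<Gamma>" and vl: "v \<longlonglongrightarrow> l"
  show "l \<in> limit_cone n \<Gamma>"
  proof (cases "l = 0")
    case True
    then show ?thesis by (simp add: limit_cone_def)
  next
    case False
    then have "\<forall>\<^sub>F j in sequentially. v j \<noteq> 0" using vl by (rule tendsto_imp_eventually_ne[rotated])
    then obtain m where m: "\<And>j. j \<ge> m \<Longrightarrow> v j \<noteq> 0" by (auto simp: eventually_sequentially)
    define w where "w j = v (j + m)" for j
    have wl: "w \<longlonglongrightarrow> l" unfolding w_def by (rule LIMSEQ_ignore_initial_segment[OF vl])
    have "w j \<noteq> 0" "w j \<in> limit_cone n \<Gamma>" for j using v m by (auto simp: w_def)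
    then have "\<exists>b. limit_plane n \<Gamma> b \<and> w j \<in> pspan n b" for j by (auto simp: limit_cone_def)
    then obtain b where b: "\<And>j. limit_plane n \<Gamma> (b j)" "\<And>j. w j \<in> pspan n (b j)" by metis
    have "\<exists>S. hat_limit n \<Gamma> S \<and> norm S = 1 \<and> (\<forall>c. \<exists>\<mu>. S *v plv n c = \<mu> *s plv n (b j))" for j
    proof -
      obtain S x where S: "hat_limit n \<Gamma> S" "plv n (b j) = S *v x"
        by (rule limit_plane_imp_hat_limit[OF b(1)[of j]])
      have nz: "plv n (b j) \<noteq> 0" using b(1)[of j] by (intro plv_basis_nonzero) (simp add: limit_plane_def)
      then have "S \<noteq> 0" using S(2) by auto
      \<comment> \<open>Unit norm yields both a convergent subsequence and a nonzero limit.\<close>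
      let ?k = "complex_of_real (inverse (norm S))"
      have "\<exists>\<mu>. cscale ?k S *v plv n c = \<mu> *s plv n (b j)" for c
        using image_proportional_limit_plane[OF S nz, of c] by (auto simp: cscale_mult_vec vector_smult_assoc)
      moreover have "norm (cscale ?k S) = 1" using \<open>S \<noteq> 0\<close> by (simp only: cscale_of_real norm_scaleR) simp
      moreover have "hat_limit n \<Gamma> (cscale ?k S)" using \<open>S \<noteq> 0\<close> by (intro hat_limit_cscale S(1)) simp
      ultimately show ?thesis by blast
    qed
    then obtain S where S: "\<And>j. hat_limit n \<Gamma> (S j)" "\<And>j. norm (S j) = 1"
      "\<And>j c. \<exists>\<mu>. S j *v plv n c = \<mu> *s plv n (b j)" by metis
    have "bounded (range S)" unfolding bounded_iff using S(2) by auto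
    then obtain T r where r: "strict_mono r" "(S \<circ> r) \<longlonglongrightarrow> T"
      using bounded_imp_convergent_subsequence by blast
    have lim: "(\<lambda>j. S (r j)) \<longlonglongrightarrow> T" using r(2) by (simp add: o_def)
    have T: "hat_limit n \<Gamma> T" by (rule hat_limit_closed[OF S(1) lim])
    have "norm T = 1" using LIMSEQ_unique[OF tendsto_norm[OF lim]] by (simp add: S(2))
    then have "T \<noteq> 0" by auto
    then obtain x where "T *v x \<noteq> 0" using matrix_eq[of T 0] by auto
    then obtain a where a: "T *v plv n a \<noteq> 0" using hat_limit_nonzero_image[OF T] by blast
    \<comment> \<open>The factors \<mu> are the scalings under which the Pluecker vectors of the
      \<open>b j\<close> converge along the subsequence.\<close>
    obtain \<mu> where \<mu>: "\<And>j. S j *v plv n a = \<mu> j *s plv n (b j)"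
      using choice[of "\<lambda>j \<mu>. S j *v plv n a = \<mu> *s plv n (b j)"] S(3) by blast
    have "(\<lambda>j. \<mu> (r j) *s plv n (b (r j))) \<longlonglongrightarrow> T *v plv n a"
      using tendsto_mult_vec[OF lim tendsto_const, of "plv n a"] by (simp only: \<mu>)
    moreover have "(\<lambda>j. w (r j)) \<longlonglongrightarrow> l" using LIMSEQ_subseq_LIMSEQ[OF wl r(1)] by (simp add: o_def)
    ultimately show ?thesis by (rule limit_point_in_limit_cone[OF \<Gamma>_PGL T _ a]) (rule b(2))
  qed
qed

text \<open>Composing the limit map with the exterior power of \<open>A\<close> gives another limit
  map, whose image contains the Pluecker vector of the translated n-plane.\<close>

lemma limit_cone_mult:
  assumes g: "g \<in> \<Gamma>" "A \<in> g" and v: "v \<in> limit_cone n \<Gamma>"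
  shows "A *v v \<in> limit_cone n \<Gamma>"
proof (cases "v = 0")
  case True
  then show ?thesis by (simp add: limit_cone_def)
next
  case False
  then obtain b where b: "limit_plane n \<Gamma> b" "v \<in> pspan n b" using v by (auto simp: limit_cone_def)
  obtain S x where S: "hat_limit n \<Gamma> S" "plv n b = S *v x"
    by (rule limit_plane_imp_hat_limit[OF b(1)])
  have inv: "invertible A" using g \<Gamma>_PGL PGL_invertible by blast
  let ?b = "\<lambda>s. A *v b s"
  have nz: "plv n ?b \<noteq> 0"
    using b(1) by (intro plv_mult_invertible_nonzero[OF inv] plv_basis_nonzero) (simp add: limit_plane_def)
  have "hat_limit n \<Gamma> (hat n A ** S)"
    using discrete by (intro hat_limit_mult[OF \<Gamma>_PGL _ g S(1)]) (auto simp: discrete_subgroup_def g)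
  moreover have "plv n ?b = (hat n A ** S) *v x"
    by (simp only: cauchy_binet_plv S(2) matrix_vector_mul_assoc)
  ultimately have "limit_plane n \<Gamma> ?b"
    using nz by (intro hat_limit_imp_limit_plane[OF \<Gamma>_PGL]) (auto intro: nplane_basis_if_plv_nonzero)
  moreover have "A *v v \<in> pspan n ?b" using b(2) by (simp add: pspan_mult)
  ultimately show ?thesis by (auto simp: limit_cone_def)
qed

lemma limit_cone_mult_iff:
  assumes g: "g \<in> \<Gamma>" "A \<in> g"
  shows "A *v v \<in> limit_cone n \<Gamma> \<longleftrightarrow> v \<in> limit_cone n \<Gamma>"
proof
  have inv: "invertible A" using g \<Gamma>_PGL PGL_invertible by blast
  have "pinv g \<in> \<Gamma>" "matrix_inv A \<in> pinv g"
    using discrete g by (auto simp: discrete_subgroup_def pinv_def)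
  moreover assume "A *v v \<in> limit_cone n \<Gamma>"
  ultimately have "matrix_inv A *v (A *v v) \<in> limit_cone n \<Gamma>" by (rule limit_cone_mult)
  then show "v \<in> limit_cone n \<Gamma>" by (simp add: matrix_vector_mul_assoc matrix_inv_works(2)[OF inv])
qed (rule limit_cone_mult[OF g])

text \<open>Missing the closed limit cone is an open condition on n-planes, and not being killed by
  \<open>S\<close> is a dense one, so some n-plane near \<open>b0\<close> satisfies both. Otherwise
  unit vectors in the intersections would accumulate at a unit vector in \<open>b0\<close> and in
  the cone.\<close>

lemma ex_generic_nplane:
  fixes S :: "'k set cmat" and a :: "nat \<Rightarrow> 'k cvec"
  assumes a: "S *v plv n a \<noteq> 0"
  shows "\<exists>c. S *v plv n c \<noteq> 0 \<and> pspan n c \<inter> limit_cone n \<Gamma> \<subseteq> {0}"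
proof (rule ccontr)
  assume "\<not> ?thesis"
  then have meet: "\<not> pspan n c \<inter> limit_cone n \<Gamma> \<subseteq> {0}" if "S *v plv n c \<noteq> 0" for c
    using that by blast
  have "\<exists>c. (\<forall>s<Suc n. dist (c s) (b0 s) < inverse (real (Suc j))) \<and> S *v plv n c \<noteq> 0" for j
    by (rule nonvanishing_dense[OF a]) simp
  then obtain c where c: "\<And>j s. s < Suc n \<Longrightarrow> dist (c j s) (b0 s) < inverse (real (Suc j))"
    "\<And>j. S *v plv n (c j) \<noteq> 0" by metis
  have "\<exists>x. norm x = 1 \<and> x \<in> pspan n (c j) \<and> x \<in> limit_cone n \<Gamma>" for j
  proof -
    obtain y where y: "y \<in> pspan n (c j)" "y \<in> limit_cone n \<Gamma>" "y \<noteq> 0" using meet[OF c(2)[of j]] by blast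
    show ?thesis
      using y by (intro exI[of _ "complex_of_real (inverse (norm y)) *s y"])
        (auto simp: norm_cmult_vec norm_inverse intro: limit_cone_scale vec.subspace_scale[OF subspace_pspan])
  qed
  then obtain x where x: "\<And>j. norm (x j) = 1" "\<And>j. x j \<in> pspan n (c j)" "\<And>j. x j \<in> limit_cone n \<Gamma>" by metis
  have "bounded (range x)" unfolding bounded_iff using x(1) by auto
  then obtain l r where r: "strict_mono r" "(x \<circ> r) \<longlonglongrightarrow> l"
    using bounded_imp_convergent_subsequence by blast
  have xl: "(\<lambda>j. x (r j)) \<longlonglongrightarrow> l" using r(2) by (simp add: o_def)
  have "norm l = 1" using LIMSEQ_unique[OF tendsto_norm[OF xl]] by (simp add: x(1))
  have "l \<in> limit_cone n \<Gamma>" by (rule closed_sequentially[OF closed_limit_cone x(3) xl])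
  have cb: "(\<lambda>j. c j s) \<longlonglongrightarrow> b0 s" if "s < Suc n" for s
  proof -
    have "(\<lambda>j. dist (c j s) (b0 s)) \<longlonglongrightarrow> 0"
      by (rule tendsto_sandwich[OF _ _ tendsto_const LIMSEQ_inverse_real_of_nat])
         (intro always_eventually allI, use c(1)[OF that] in \<open>auto intro: less_imp_le simp del: of_nat_Suc\<close>)+
    then show ?thesis by (subst tendsto_dist_iff)
  qed
  have "(\<lambda>j. c (r j) s) \<longlonglongrightarrow> b0 s" if "s < Suc n" for s
    using LIMSEQ_subseq_LIMSEQ[OF cb[OF that] r(1)] by (simp add: o_def)
  then have "(\<lambda>j. plv n (c (r j))) \<longlonglongrightarrow> plv n b0" by (rule tendsto_plv)
  then have "(\<lambda>j. 1 *s plv n (c (r j))) \<longlonglongrightarrow> plv n b0" by simp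
  from plucker_limit[OF this plv_basis_nonzero[OF b0]]
  obtain b' where b': "plv n b' = plv n b0" "l \<in> pspan n b'" using xl x(2) by blast
  note b'(2)
  also have "pspan n b' = pspan n b0"
    using b'(1) plv_basis_nonzero[OF b0] by (intro pspan_eq_if_plv_proportional[where k = 1]) simp_all
  finally have "l = 0" using \<open>l \<in> limit_cone n \<Gamma>\<close> disj by blast
  with \<open>norm l = 1\<close> show False by simp
qed

text \<open>The translates of a generic n-plane near b0 avoid the limit cone and converge to the limit
  n-plane through v, because the limit map has rank one on decomposable vectors.\<close>
lemma complement_limit_cone_dense:
  assumes v: "v \<in> limit_cone n \<Gamma>" "v \<noteq> 0" and U: "open U" "v \<in> U"
  shows "\<exists>u\<in>U. u \<notin> limit_cone n \<Gamma>"
proof -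
  obtain b where b: "limit_plane n \<Gamma> b" "v \<in> pspan n b" using v by (auto simp: limit_cone_def)
  obtain S x where S: "hat_limit n \<Gamma> S" "plv n b = S *v x"
    by (rule limit_plane_imp_hat_limit[OF b(1)])
  have nz: "plv n b \<noteq> 0" using b(1) by (intro plv_basis_nonzero) (simp add: limit_plane_def)
  obtain c where c: "S *v plv n c \<noteq> 0" "pspan n c \<inter> limit_cone n \<Gamma> \<subseteq> {0}"
    using hat_limit_nonzero_image[OF S(1), of x] ex_generic_nplane nz S(2) by metis
  obtain \<mu> where \<mu>: "S *v plv n c = \<mu> *s plv n b"
    using image_proportional_limit_plane[OF S nz] by blast
  obtain \<sigma> A k where s: "inj \<sigma>" "\<And>\<nu>. \<sigma> \<nu> \<in> \<Gamma>" "\<And>\<nu>. A \<nu> \<in> \<sigma> \<nu>" "\<And>\<nu>. k \<nu> \<noteq> 0"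
    and lim: "(\<lambda>\<nu>. cscale (k \<nu>) (hat n (A \<nu>))) \<longlonglongrightarrow> S"
    using hat_limit_sequence[OF S(1)] by blast
  have lim': "(\<lambda>\<nu>. k \<nu> *s plv n (\<lambda>t. A \<nu> *v c t)) \<longlonglongrightarrow> S *v plv n c"
    using tendsto_mult_vec[OF lim tendsto_const, of "plv n c"]
    by (simp only: cscale_mult_vec cauchy_binet_plv)
  obtain b' where b': "plv n b' = S *v plv n c"
    "\<forall>y\<in>pspan n b'. \<exists>x. x \<longlonglongrightarrow> y \<and> (\<forall>\<^sub>F \<nu> in sequentially. x \<nu> \<in> pspan n (\<lambda>t. A \<nu> *v c t))"
    using plucker_limit[OF lim' c(1)] by blast
  \<comment> \<open>\<open>S\<close> maps \<open>c\<close> to a multiple of the Pluecker vector of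
    \<open>b\<close>, so the translates of \<open>c\<close> converge to \<open>b\<close>
    itself.\<close>
  have "pspan n b' = pspan n b"
    using b'(1) c(1) \<mu> by (intro pspan_eq_if_plv_proportional[where k = \<mu>]) simp_all
  then obtain x where x: "x \<longlonglongrightarrow> v" "\<forall>\<^sub>F \<nu> in sequentially. x \<nu> \<in> pspan n (\<lambda>t. A \<nu> *v c t)"
    using b'(2) b(2) by blast
  have "\<forall>\<^sub>F \<nu> in sequentially. x \<nu> \<in> U" by (rule topological_tendstoD[OF x(1) U])
  moreover have "\<forall>\<^sub>F \<nu> in sequentially. x \<nu> \<noteq> 0" by (rule tendsto_imp_eventually_ne[OF x(1) v(2)])
  ultimately have "\<forall>\<^sub>F \<nu> in sequentially. x \<nu> \<in> U \<and> x \<nu> \<noteq> 0 \<and> x \<nu> \<in> pspan n (\<lambda>t. A \<nu> *v c t)"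
    using x(2) by eventually_elim simp
  then obtain \<nu> where \<nu>: "x \<nu> \<in> U" "x \<nu> \<noteq> 0" "x \<nu> \<in> pspan n (\<lambda>t. A \<nu> *v c t)"
    by (auto simp: eventually_sequentially)
  from \<nu>(3) obtain y where y: "y \<in> pspan n c" "x \<nu> = A \<nu> *v y" by (auto simp: pspan_mult)
  \<comment> \<open>By invariance the preimage \<open>y\<close> would lie both in the cone and in
    the generic n-plane.\<close>
  have "x \<nu> \<notin> limit_cone n \<Gamma>"
  proof
    assume "x \<nu> \<in> limit_cone n \<Gamma>"
    then have "y \<in> limit_cone n \<Gamma>" using limit_cone_mult_iff[OF s(2,3)] y(2) by simp
    then have "y = 0" using y(1) c(2) by blast
    then show False using \<nu>(2) y(2) by simp
  qed
  with \<nu>(1) show ?thesis by blast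
qed

end

section \<open>The limit set in projective space\<close>

lemma mem_ppt: "v \<in> ppt v"
  unfolding ppt_def by (auto intro!: exI[of _ 1])

lemma ppt_eq: "w \<in> ppt v \<Longrightarrow> ppt w = ppt v"
proof -
  assume "w \<in> ppt v"
  then obtain c where c: "c \<noteq> 0" "w = c *s v" by (auto simp: ppt_def)
  show "ppt w = ppt v"
  proof (intro equalityI subsetI)
    fix x assume "x \<in> ppt w"
    then show "x \<in> ppt v" using c by (auto simp: ppt_def vector_smult_assoc)
  next
    fix x assume "x \<in> ppt v"
    then obtain d where "d \<noteq> 0" "x = d *s v" by (auto simp: ppt_def)
    then have "d / c \<noteq> 0" "x = (d / c) *s w" using c by (auto simp: vector_smult_assoc)
    then show "x \<in> ppt w" unfolding ppt_def by blast
  qed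
qed

lemma Union_points: "V \<subseteq> Pspace \<Longrightarrow> \<Union>V = {v. v \<noteq> 0 \<and> ppt v \<in> V}"
proof (intro equalityI subsetI)
  fix v assume V: "V \<subseteq> Pspace" and "v \<in> \<Union>V"
  then obtain w where w: "w \<noteq> 0" "ppt w \<in> V" "v \<in> ppt w" by (auto simp: Pspace_def)
  then have "v \<noteq> 0" by (auto simp: ppt_def)
  with w(2) ppt_eq[OF w(3)] show "v \<in> {v. v \<noteq> 0 \<and> ppt v \<in> V}" by auto
qed (use mem_ppt in auto)

text \<open>The predicate in \<open>Ptop\<close> is stable under intersection because distinct
  points are disjoint sets of vectors, so that taking unions commutes with intersections.\<close>

lemma openin_Ptop: "openin Ptop U \<longleftrightarrow> U \<subseteq> Pspace \<and> open (\<Union>U)"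
  for U :: "'k::finite cvec set set"
proof -
  have "istopology (\<lambda>U :: 'k cvec set set. U \<subseteq> Pspace \<and> open (\<Union>U))"
    unfolding istopology_def
  proof (intro conjI allI impI)
    fix V W :: "'k cvec set set"
    assume V: "V \<subseteq> Pspace \<and> open (\<Union>V)" and W: "W \<subseteq> Pspace \<and> open (\<Union>W)"
    then show "V \<inter> W \<subseteq> Pspace" by blast
    have "\<Union>(V \<inter> W) = \<Union>V \<inter> \<Union>W"
      using V W by (subst (1 2 3) Union_points) auto
    then show "open (\<Union>(V \<inter> W))" using V W by auto
  next
    fix \<K> :: "'k cvec set set set" assume K: "\<forall>K\<in>\<K>. K \<subseteq> Pspace \<and> open (\<Union>K)"
    then show "\<Union>\<K> \<subseteq> Pspace" by blast
    have "\<Union>(\<Union>\<K>) = (\<Union>K\<in>\<K>. \<Union>K)" by blast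
    then show "open (\<Union>(\<Union>\<K>))" using K by auto
  qed
  then show ?thesis by (simp add: Ptop_def)
qed

lemma topspace_Ptop: "topspace Ptop = (Pspace :: 'k::finite cvec set set)"
proof -
  have "\<Union>(Pspace :: 'k cvec set set) = - {0}"
    by (subst Union_points) (auto simp: Pspace_def)
  then have "openin Ptop (Pspace :: 'k cvec set set)" by (simp add: openin_Ptop open_Compl)
  then show ?thesis
    by (metis openin_Ptop openin_subset openin_topspace subset_antisym)
qed

lemma limset_eq: "limset n \<Gamma> = {ppt v | v. v \<noteq> 0 \<and> v \<in> limit_cone n \<Gamma>}"
proof (intro equalityI subsetI)
  fix p assume "p \<in> limset n \<Gamma>"
  then obtain b where b: "limit_plane n \<Gamma> b" "p \<in> plane_pts n b" by (auto simp: limset_def)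
  then obtain v where v: "p = ppt v" "v \<noteq> 0" by (auto simp: plane_pts_def)
  then have "v \<in> pspan n b" using b(2) mem_plane_pts_iff by blast
  with b(1) v show "p \<in> {ppt v | v. v \<noteq> 0 \<and> v \<in> limit_cone n \<Gamma>}" unfolding limit_cone_def by blast
next
  fix p assume "p \<in> {ppt v | v. v \<noteq> 0 \<and> v \<in> limit_cone n \<Gamma>}"
  then obtain v where v: "p = ppt v" "v \<noteq> 0" "v \<in> limit_cone n \<Gamma>" by blast
  then obtain b where b: "limit_plane n \<Gamma> b" "v \<in> pspan n b" by (auto simp: limit_cone_def)
  then have "p \<in> plane_pts n b" using v mem_plane_pts_iff by blast
  with b(1) show "p \<in> limset n \<Gamma>" by (auto simp: limset_def)
qed

lemma ppt_in_limset_iff: "v \<noteq> 0 \<Longrightarrow> ppt v \<in> limset n \<Gamma> \<longleftrightarrow> v \<in> limit_cone n \<Gamma>"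
proof
  assume "v \<noteq> 0" "ppt v \<in> limset n \<Gamma>"
  then obtain w where w: "ppt v = ppt w" "w \<in> limit_cone n \<Gamma>" by (auto simp: limset_eq)
  then obtain c where "v = c *s w" using mem_ppt[of v] by (auto simp: ppt_def)
  then show "v \<in> limit_cone n \<Gamma>" using limit_cone_scale w(2) by blast
qed (auto simp: limset_eq)

lemma limset_subset_Pspace: "limset n \<Gamma> \<subseteq> Pspace"
  by (auto simp: limset_eq Pspace_def)

lemma pact_ppt:
  assumes "g \<in> PGL" "A \<in> g"
  shows "pact g (ppt v) = ppt (A *v v)"
proof (intro equalityI subsetI)
  have gA: "g = pcls A" using PGL_eq_pcls[OF assms] .
  fix x assume "x \<in> pact g (ppt v)"
  then obtain c d where "c \<noteq> 0" "d \<noteq> 0" "x = cscale c A *v (d *s v)"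
    unfolding pact_def gA pcls_def' ppt_def by blast
  then have "c * d \<noteq> 0" "x = (c * d) *s (A *v v)"
    by (simp_all add: cscale_mult_vec vec.scale vector_smult_assoc)
  then show "x \<in> ppt (A *v v)" unfolding ppt_def by blast
next
  fix x assume "x \<in> ppt (A *v v)"
  then obtain c where "c \<noteq> 0" "x = A *v (c *s v)" by (auto simp: ppt_def vec.scale)
  then show "x \<in> pact g (ppt v)" unfolding pact_def ppt_def using assms(2) by blast
qed

theorem theorem4p10:
  fixes \<Gamma> :: "'k::{finite,linorder} cmat set set" and n :: nat
  assumes "n \<ge> 1" and "CARD('k) = 2 * n + 2" and "type_L n \<Gamma>"
  shows "closedin Ptop (limset n \<Gamma>)
    \<and> Ptop interior_of (Ptop closure_of (limset n \<Gamma>)) = {}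
    \<and> (\<forall>g\<in>\<Gamma>. pact g ` limset n \<Gamma> = limset n \<Gamma>)"
proof -
  obtain D b0 where D: "nplane_basis n b0" "plane_pts n b0 \<subseteq> D" "D \<subseteq> Pspace - limset n \<Gamma>"
    and \<Gamma>: "discrete_subgroup \<Gamma>"
    using assms(3) by (auto simp: type_L_def)
  have "pspan n b0 \<inter> limit_cone n \<Gamma> \<subseteq> {0}"
  proof
    fix v assume v: "v \<in> pspan n b0 \<inter> limit_cone n \<Gamma>"
    show "v \<in> {0}"
    proof (rule ccontr)
      assume "v \<notin> {0}"
      then have "ppt v \<in> plane_pts n b0" "ppt v \<in> limset n \<Gamma>"
        using v by (simp_all add: mem_plane_pts_iff ppt_in_limset_iff)
      then show False using D(2,3) by blast
    qed
  qed
  then interpret nplane_off_limit_cone n \<Gamma> b0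
    using assms(2) \<Gamma> D(1) by unfold_locales
  \<comment> \<open>The cone contains 0 and no point of projective space does, so the points off the
    limit set fill exactly the complement of the cone.\<close>
  have "\<Union>(Pspace - limset n \<Gamma>) = - limit_cone n \<Gamma>"
    by (subst Union_points) (auto simp: Pspace_def ppt_in_limset_iff limit_cone_def)
  then have closed: "closedin Ptop (limset n \<Gamma>)"
    using closed_limit_cone limset_subset_Pspace[of n \<Gamma>]
    by (auto simp: closedin_def topspace_Ptop openin_Ptop open_Compl)
  have "U = {}" if U: "openin Ptop U" "U \<subseteq> limset n \<Gamma>" for U
  proof (rule ccontr)
    assume "U \<noteq> {}"
    have U': "U \<subseteq> Pspace" "open (\<Union>U)" using U(1) by (auto simp: openin_Ptop)
    then obtain v where v: "v \<noteq> 0" "ppt v \<in> U" using \<open>U \<noteq> {}\<close> by (auto simp: Pspace_def)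
    have "v \<in> limit_cone n \<Gamma>" using v U(2) ppt_in_limset_iff by blast
    moreover have "v \<in> \<Union>U" using v(2) mem_ppt by blast
    ultimately obtain u where u: "u \<in> \<Union>U" "u \<notin> limit_cone n \<Gamma>"
      using complement_limit_cone_dense v(1) U'(2) by blast
    then have "u \<noteq> 0" "ppt u \<in> U" using Union_points[OF U'(1)] by auto
    then show False using u(2) U(2) ppt_in_limset_iff by blast
  qed
  then have interior: "Ptop interior_of (limset n \<Gamma>) = {}"
    by (metis interior_of_subset openin_interior_of)
  have "pact g ` limset n \<Gamma> = limset n \<Gamma>" if g: "g \<in> \<Gamma>" for g
  proof -
    have gP: "g \<in> PGL" using g \<Gamma>_PGL by blast
    then obtain A where A: "A \<in> g" using PGL_nonempty by blast
    have inv: "invertible A" using PGL_invertible[OF gP A] .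
    note inv' = matrix_inv_works[OF inv]
    have Av: "A *v v = 0 \<longleftrightarrow> v = 0" for v
      by (metis inv'(2) matrix_vector_mul_assoc matrix_vector_mul_lid matrix_vector_mult_0_right)
    show ?thesis
    proof (intro equalityI subsetI)
      fix p assume "p \<in> pact g ` limset n \<Gamma>"
      then obtain v where v: "v \<noteq> 0" "v \<in> limit_cone n \<Gamma>" "p = pact g (ppt v)" by (auto simp: limset_eq)
      then show "p \<in> limset n \<Gamma>"
        using limit_cone_mult[OF g A v(2)] by (simp add: pact_ppt[OF gP A] ppt_in_limset_iff Av)
    next
      fix p assume "p \<in> limset n \<Gamma>"
      then obtain v where v: "v \<noteq> 0" "v \<in> limit_cone n \<Gamma>" "p = ppt v" by (auto simp: limset_eq)
      \<comment> \<open>The preimage of \<open>v\<close> under \<open>A\<close>; it stays in the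
        cone because membership is invariant in both directions.\<close>
      let ?w = "matrix_inv A *v v"
      have w: "A *v ?w = v" by (simp add: matrix_vector_mul_assoc inv'(1))
      then have "?w \<noteq> 0" "?w \<in> limit_cone n \<Gamma>" using v Av[of ?w] limit_cone_mult_iff[OF g A, of ?w] by auto
      then have "ppt ?w \<in> limset n \<Gamma>" by (simp add: ppt_in_limset_iff)
      moreover have "pact g (ppt ?w) = p" by (simp add: pact_ppt[OF gP A] w v(3))
      ultimately show "p \<in> pact g ` limset n \<Gamma>" by blast
    qed
  qed
  then show ?thesis using closed interior by (simp add: closure_of_closedin)
qed

end
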